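(* If $\mathbb{k}$ contains a primitive $2k$-th root of unity, then $\mathrm{Cl}_q(n,k)$ is semisimple; in fact $\mathrm{Cl}_q(n,k)$ is isomorphic as a $\mathbb{k}$-algebra to a direct sum of $(2k)^n$ copies of the matrix algebra $\mathrm{Mat}_{2^n}(\mathbb{k})$.
   Context: Let $\mathbb{k}$ be a field of characteristic different from $2$, let $q\in\mathbb{k}^\times$, and let $n,k$ be positive integers. The quantum Clifford algebra $\mathrm{Cl}_q(n,k)$ is the unital associative $\mathbb{k}$-algebra generated by $\psi_a,\psi_a^*,\omega_a,\omega_a^{-1}$ for $a\in\{1,\dots,n\}$, subject to the relations (for all $a,b\in\{1,\dots,n\}$): $\omega_a\omega_b=\omega_b\omega_a$; $\omega_a\omega_a^{-1}=1$; $\omega_a\psi_b=q^{\delta_{ab}}\psi_b\omega_a$; $\omega_a\psi_b^*=q^{-\delta_{ab}}\psi_b^*\omega_a$; $\psi_a\psi_b+\psi_b\psi_a=0$; $\psi_a^*\psi_b^*+\psi_b^*\psi_a^*=0$; $\psi_a\psi_a^*+q^k\psi_a^*\psi_a=\omega_a^{-k}$; $\psi_a\psi_a^*+q^{-k}\psi_a^*\psi_a=\omega_a^{k}$; and $\psi_a\psi_b^*+\psi_b^*\psi_a=0$ if $a\neq b$. *)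

theory Defs
  imports Main
begin

datatype gen = Psi nat | PsiS nat | Om nat | OmInv nat

definition gens :: "nat \<Rightarrow> gen set" where
  "gens n = {g. \<exists>a\<in>{1..n}. g = Psi a \<or> g = PsiS a \<or> g = Om a \<or> g = OmInv a}"

definition FA :: "nat \<Rightarrow> (gen list \<Rightarrow> 'k::field) set" where
  "FA n = {f. finite {w. f w \<noteq> 0} \<and> (\<forall>w. f w \<noteq> 0 \<longrightarrow> set w \<subseteq> gens n)}"

definition fa_add :: "(gen list \<Rightarrow> 'k::field) \<Rightarrow> (gen list \<Rightarrow> 'k) \<Rightarrow> gen list \<Rightarrow> 'k" where
  "fa_add f g = (\<lambda>w. f w + g w)"

definition fa_smul :: "'k::field \<Rightarrow> (gen list \<Rightarrow> 'k) \<Rightarrow> gen list \<Rightarrow> 'k" where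
  "fa_smul c f = (\<lambda>w. c * f w)"

definition fa_mult :: "(gen list \<Rightarrow> 'k::field) \<Rightarrow> (gen list \<Rightarrow> 'k) \<Rightarrow> gen list \<Rightarrow> 'k" where
  "fa_mult f g = (\<lambda>w. \<Sum>i\<in>{0..length w}. f (take i w) * g (drop i w))"

definition fa_one :: "gen list \<Rightarrow> 'k::field" where
  "fa_one = (\<lambda>w. if w = [] then 1 else 0)"

definition lin :: "('k::field \<times> gen list) list \<Rightarrow> gen list \<Rightarrow> 'k" where
  "lin cs = (\<lambda>w. \<Sum>(c,u)\<leftarrow>cs. if u = w then c else 0)"

section \<open>Defining relations of Cl_q(n,k) (as elements r meaning r = 0)\<close>

definition cl_rels :: "nat \<Rightarrow> nat \<Rightarrow> 'k::field \<Rightarrow> (gen list \<Rightarrow> 'k) set" where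
  "cl_rels n k q =
     {lin [(1, [Om a, Om b]), (-1, [Om b, Om a])] | a b. a \<in> {1..n} \<and> b \<in> {1..n}}
   \<union> {lin [(1, [Om a, OmInv a]), (-1, [])] | a. a \<in> {1..n}}
   \<union> {lin [(1, [Om a, Psi b]), (- (if a = b then q else 1), [Psi b, Om a])] | a b. a \<in> {1..n} \<and> b \<in> {1..n}}
   \<union> {lin [(1, [Om a, PsiS b]), (- (if a = b then inverse q else 1), [PsiS b, Om a])] | a b. a \<in> {1..n} \<and> b \<in> {1..n}}
   \<union> {lin [(1, [Psi a, Psi b]), (1, [Psi b, Psi a])] | a b. a \<in> {1..n} \<and> b \<in> {1..n}}
   \<union> {lin [(1, [PsiS a, PsiS b]), (1, [PsiS b, PsiS a])] | a b. a \<in> {1..n} \<and> b \<in> {1..n}}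
   \<union> {lin [(1, [Psi a, PsiS a]), (q ^ k, [PsiS a, Psi a]), (-1, replicate k (OmInv a))] | a. a \<in> {1..n}}
   \<union> {lin [(1, [Psi a, PsiS a]), (inverse q ^ k, [PsiS a, Psi a]), (-1, replicate k (Om a))] | a. a \<in> {1..n}}
   \<union> {lin [(1, [Psi a, PsiS b]), (1, [PsiS b, Psi a])] | a b. a \<in> {1..n} \<and> b \<in> {1..n} \<and> a \<noteq> b}"

inductive_set cl_ideal :: "nat \<Rightarrow> nat \<Rightarrow> 'k::field \<Rightarrow> (gen list \<Rightarrow> 'k) set"
  for n k q where
  zero: "(\<lambda>_. 0) \<in> cl_ideal n k q"
| rel: "r \<in> cl_rels n k q \<Longrightarrow> a \<in> FA n \<Longrightarrow> b \<in> FA n \<Longrightarrow> fa_mult (fa_mult a r) b \<in> cl_ideal n k q"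
| add: "x \<in> cl_ideal n k q \<Longrightarrow> y \<in> cl_ideal n k q \<Longrightarrow> fa_add x y \<in> cl_ideal n k q"

text \<open>Cl_q(n,k) = FA n / cl_ideal n k q.\<close>

text \<open>An element is X c i j = (i,j) entry of the c-th component, c < N, i,j < d.\<close>
definition matsum :: "nat \<Rightarrow> nat \<Rightarrow> (nat \<Rightarrow> nat \<Rightarrow> nat \<Rightarrow> 'k::field) set" where
  "matsum N d = {X. \<forall>c i j. X c i j \<noteq> 0 \<longrightarrow> c < N \<and> i < d \<and> j < d}"

definition ms_add :: "(nat \<Rightarrow> nat \<Rightarrow> nat \<Rightarrow> 'k::field) \<Rightarrow> _ \<Rightarrow> _" where
  "ms_add X Y = (\<lambda>c i j. X c i j + Y c i j)"

definition ms_smul :: "'k::field \<Rightarrow> (nat \<Rightarrow> nat \<Rightarrow> nat \<Rightarrow> 'k) \<Rightarrow> _" where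
  "ms_smul a X = (\<lambda>c i j. a * X c i j)"

definition ms_mult :: "nat \<Rightarrow> (nat \<Rightarrow> nat \<Rightarrow> nat \<Rightarrow> 'k::field) \<Rightarrow> _ \<Rightarrow> _" where
  "ms_mult d X Y = (\<lambda>c i j. \<Sum>l<d. X c i l * Y c l j)"

definition ms_one :: "nat \<Rightarrow> nat \<Rightarrow> nat \<Rightarrow> nat \<Rightarrow> nat \<Rightarrow> 'k::field" where
  "ms_one N d = (\<lambda>c i j. if c < N \<and> i < d \<and> i = j then 1 else 0)"

definition primitive_root_of_unity :: "nat \<Rightarrow> 'k::field \<Rightarrow> bool" where
  "primitive_root_of_unity m z \<longleftrightarrow> z ^ m = 1 \<and> (\<forall>j. 0 < j \<and> j < m \<longrightarrow> z ^ j \<noteq> 1)"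

end

theory Submission
  imports Defs "HOL-Library.Function_Algebras" "HOL-Library.FuncSet" "HOL-Computational_Algebra.Polynomial"
begin

text \<open>For every choice of \<open>2k\<close>-th roots of unity \<open>\<zeta>\<^sub>1, \<dots>, \<zeta>\<^sub>n\<close> the algebra acts on a space with basis indexed
  by the subsets of \<open>{1..n}\<close>, by Jordan-Wigner signed creation and annihilation operators, with \<open>\<omega>\<^sub>a\<close>
  diagonal with eigenvalues \<open>\<zeta>\<^sub>a\<close> and \<open>\<zeta>\<^sub>a q\<^sup>-\<^sup>1\<close>. Together these \<open>(2k)\<^sup>n\<close> representations give the map to the sum
  of matrix algebras.

  It is surjective: the diagonal matrices in the image separate the pairs (weight, subset), so by
  interpolation all diagonal matrix units occur, and \<open>\<psi>\<^sub>a\<close>, \<open>\<psi>\<^sub>a\<^sup>*\<close> move them to all other matrix units.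

  Its kernel is the ideal of relations: \<open>(\<psi>\<^sub>a\<psi>\<^sub>a\<^sup>*)\<^sup>2 + (\<psi>\<^sub>a\<^sup>*\<psi>\<^sub>a)\<^sup>2 = 1\<close> and \<open>\<omega>\<^sub>a\<^sup>2\<^sup>k\<psi>\<^sub>a = \<psi>\<^sub>a\<close> show, one index \<open>a\<close> at a time,
  that the quotient is spanned by vectors obtained from highest weight vectors by applying the
  \<open>\<psi>\<^sub>a\<^sup>*\<close>, and on these the generators act by the matrices above. So an element with zero matrices
  annihilates the quotient, in particular its unit.\<close>

section \<open>The simple modules\<close>

text \<open>The module of weight \<open>\<zeta>\<close> has a basis \<open>e\<^sub>S\<close>, \<open>S \<subseteq> {1..n}\<close>, where \<open>e\<^sub>S\<close> is the ordered product of the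
  \<open>\<psi>\<^sub>a\<^sup>*\<close>, \<open>a \<in> S\<close>, applied to a vector that every \<open>\<psi>\<^sub>a\<close> kills and on which \<open>\<omega>\<^sub>a\<close> acts by \<open>\<zeta> a\<close>. A generator
  \<open>g\<close> sends \<open>e\<^sub>S\<close> to \<open>gen_coef g S\<close> times the basis vector of \<open>gen_move g S\<close>; the latter is
  meaningless where the coefficient vanishes.\<close>

definition jw_sign :: "nat \<Rightarrow> nat set \<Rightarrow> 'k::field" where
  "jw_sign b S = (-1) ^ card {a \<in> S. a < b}"

fun gen_move :: "gen \<Rightarrow> nat set \<Rightarrow> nat set" where
  "gen_move (Psi b) S = S - {b}"
| "gen_move (PsiS b) S = insert b S"
| "gen_move (Om b) S = S"
| "gen_move (OmInv b) S = S"

text \<open>The values are forced by the relations. Passing the factors with index below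
  \<open>b\<close> costs the sign; \<open>Om b\<close> picks up \<open>inverse q\<close> from a
  factor \<open>PsiS b\<close>; and \<open>\<zeta> b ^ k\<close> is the value of
  \<open>Psi b\<close> after \<open>PsiS b\<close> on a vector killed by \<open>Psi b\<close>, by
  the relation for the \<open>k\<close>-th power of \<open>Om b\<close>.\<close>

fun gen_coef :: "'k::field \<Rightarrow> nat \<Rightarrow> (nat \<Rightarrow> 'k) \<Rightarrow> gen \<Rightarrow> nat set \<Rightarrow> 'k" where
  "gen_coef q k \<zeta> (Psi b) S = (if b \<in> S then jw_sign b S * \<zeta> b ^ k else 0)"
| "gen_coef q k \<zeta> (PsiS b) S = (if b \<in> S then 0 else jw_sign b S)"
| "gen_coef q k \<zeta> (Om b) S = \<zeta> b * (if b \<in> S then inverse q else 1)"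
| "gen_coef q k \<zeta> (OmInv b) S = inverse (\<zeta> b * (if b \<in> S then inverse q else 1))"

abbreviation word_move :: "gen list \<Rightarrow> nat set \<Rightarrow> nat set" where
  "word_move \<equiv> foldr gen_move"

fun word_coef :: "'k::field \<Rightarrow> nat \<Rightarrow> (nat \<Rightarrow> 'k) \<Rightarrow> gen list \<Rightarrow> nat set \<Rightarrow> 'k" where
  "word_coef q k \<zeta> [] S = 1"
| "word_coef q k \<zeta> (g # w) S = gen_coef q k \<zeta> g (word_move w S) * word_coef q k \<zeta> w S"

text \<open>Weights are stored as exponents: \<open>c\<close> stands for the tuple of the
  \<open>z ^ c a\<close>. Extensional functions make their number exactly
  \<open>N ^ m\<close>.\<close>

definition weights :: "nat \<Rightarrow> nat \<Rightarrow> (nat \<Rightarrow> nat) set" where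
  "weights N m = {1..m} \<rightarrow>\<^sub>E {..<N}"

text \<open>Row \<open>T\<close>, column \<open>S\<close>. A column has at most one nonzero entry,
  because a word sends a basis vector to a multiple of a basis vector.\<close>

definition word_entry :: "'k::field \<Rightarrow> nat \<Rightarrow> (nat \<Rightarrow> 'k) \<Rightarrow> gen list \<Rightarrow> nat set \<Rightarrow> nat set \<Rightarrow> 'k" where
  "word_entry q k \<zeta> w T S = (if word_move w S = T then word_coef q k \<zeta> w S else 0)"

definition rep_entry :: "'k::field \<Rightarrow> nat \<Rightarrow> (nat \<Rightarrow> 'k) \<Rightarrow> (gen list \<Rightarrow> 'k) \<Rightarrow> nat set \<Rightarrow> nat set \<Rightarrow> 'k" where
  "rep_entry q k \<zeta> f T S = (\<Sum>w | f w \<noteq> 0. f w * word_entry q k \<zeta> w T S)"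

lemma gen_move_subset: "g \<in> gens n \<Longrightarrow> S \<subseteq> {1..n} \<Longrightarrow> gen_move g S \<subseteq> {1..n}"
  by (auto simp: gens_def)

lemma word_move_subset: "set w \<subseteq> gens n \<Longrightarrow> S \<subseteq> {1..n} \<Longrightarrow> word_move w S \<subseteq> {1..n}"
  by (induction w) (use gen_move_subset in auto)

section \<open>Roots of unity and eigenvectors\<close>

text \<open>Distinctness follows by cancelling a power of the nonzero \<open>z\<close>. If
  \<open>m\<close> were 0 in the field, then \<open>1 + x + ... + x^(m-1)\<close> would vanish at 1
  as well as at the other \<open>m\<close>-th roots of unity, which is more roots than its degree
  allows.\<close>

lemma
  fixes z :: "'k::field"
  assumes z: "primitive_root_of_unity m z" and "0 < m"
  shows primitive_root_powers_inj: "inj_on (\<lambda>j. z ^ j) {..<m}"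
    and primitive_root_order_nonzero: "(of_nat m :: 'k) \<noteq> 0"
proof -
  have zm: "z ^ m = 1" using z by (simp add: primitive_root_of_unity_def)
  then have z0: "z \<noteq> 0" using \<open>0 < m\<close> by (metis power_eq_0_iff zero_neq_one)
  have ne: "z ^ i \<noteq> z ^ j" if "i < j" "j < m" for i j
  proof
    assume "z ^ i = z ^ j"
    moreover have "z ^ j = z ^ i * z ^ (j - i)" using that by (simp flip: power_add)
    ultimately have "z ^ (j - i) = 1" using z0 by simp
    then show False using z that by (auto simp: primitive_root_of_unity_def)
  qed
  show inj: "inj_on (\<lambda>j. z ^ j) {..<m}"
    by (rule inj_onI) (metis lessThan_iff linorder_neqE_nat ne)
  show "(of_nat m :: 'k) \<noteq> 0"
  proof
    assume m0: "(of_nat m :: 'k) = 0"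
    define p :: "'k poly" where "p = (\<Sum>t<m. monom 1 t)"
    have cp: "coeff p (m - 1) = 1"
      using \<open>0 < m\<close> by (simp add: p_def coeff_sum sum.If_cases)
    then have p0: "p \<noteq> 0" by auto
    have "degree p \<le> m - 1"
      unfolding p_def by (rule degree_sum_le) (auto intro: order_trans[OF degree_monom_le])
    have "poly p (z ^ j) = 0" if "j < m" for j
    proof (cases "j = 0")
      case True
      then show ?thesis using m0 by (simp add: p_def poly_sum poly_monom)
    next
      case False
      then have "z ^ j \<noteq> 1" using z that by (auto simp: primitive_root_of_unity_def)
      moreover have "(z ^ j) ^ m = 1" by (metis zm mult.commute power_mult power_one)
      ultimately show ?thesis
        by (simp add: p_def poly_sum poly_monom geometric_sum)
    qed
    then have "(\<lambda>j. z ^ j) ` {..<m} \<subseteq> {x. poly p x = 0}" by auto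
    then have "card ((\<lambda>j. z ^ j) ` {..<m}) \<le> card {x. poly p x = 0}"
      using p0 by (intro card_mono poly_roots_finite)
    also have "\<dots> \<le> degree p" using p0 by (rule card_poly_roots_bound)
    finally show False
      using \<open>degree p \<le> m - 1\<close> \<open>0 < m\<close> card_image[OF inj] by simp
  qed
qed

context vector_space
begin

text \<open>Discrete Fourier transform along the orbit of \<open>x\<close>, possible since
  \<open>m\<close> is invertible in the field. The invariant subspace \<open>E\<close> carries along
  conditions that the eigenvectors have to inherit.\<close>

lemma eigen_decomposition:
  fixes z :: 'a
  assumes z: "primitive_root_of_unity m z" and m: "0 < m"
    and T: "Vector_Spaces.linear scale scale T"
    and E: "subspace E" "\<And>x. x \<in> E \<Longrightarrow> T x \<in> E"
    and x: "x \<in> E" "(T ^^ m) x = x"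
  obtains y where "x = (\<Sum>t<m. y t)" "\<And>t. t < m \<Longrightarrow> y t \<in> E"
    "\<And>t. t < m \<Longrightarrow> T (y t) = scale (z ^ t) (y t)"
proof -
  interpret T: Vector_Spaces.linear scale scale T by (rule T)
  have zm: "z ^ m = 1" using z by (simp add: primitive_root_of_unity_def)
  then have z0: "z \<noteq> 0" using m by (metis power_eq_0_iff zero_neq_one)
  note m0 = primitive_root_order_nonzero[OF z m]
  define y where "y t = scale (inverse (of_nat m)) (\<Sum>s<m. scale (inverse z ^ (t * s)) ((T ^^ s) x))" for t
  have TE: "(T ^^ s) x \<in> E" for s
    by (induction s) (auto simp: x E)
  show ?thesis
  proof (rule that[of y])
    show "y t \<in> E" for t
      unfolding y_def using E(1) TE by (intro subspace_scale subspace_sum) auto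
    show "T (y t) = scale (z ^ t) (y t)" for t
    proof -
      define f where "f s = scale (z ^ t) (scale (inverse z ^ (t * s)) ((T ^^ s) x))" for s
      have "T (\<Sum>s<m. scale (inverse z ^ (t * s)) ((T ^^ s) x)) = (\<Sum>s<m. f (Suc s))"
        using z0 by (simp add: f_def T.sum T.scale power_add field_simps)
      \<comment> \<open>\<open>T\<close> shifts the Fourier sum by one index; the two boundary terms
        cancel because \<open>x\<close> has period \<open>m\<close> under \<open>T\<close> and
        \<open>z ^ m = 1\<close>.\<close>
      also have "\<dots> = (\<Sum>s<m. f s) + f m - f 0"
        using sum.lessThan_Suc[of f m] sum.lessThan_Suc_shift[of f m] by (simp add: algebra_simps)
      finally have *: "T (\<Sum>s<m. scale (inverse z ^ (t * s)) ((T ^^ s) x)) = (\<Sum>s<m. f s) + f m - f 0" .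
      have "inverse z ^ (t * m) = 1"
        by (metis inverse_1 mult.commute power_inverse power_mult power_one zm)
      then have "f m = f 0"
        using x(2) by (simp add: f_def)
      with * have "T (\<Sum>s<m. scale (inverse z ^ (t * s)) ((T ^^ s) x))
          = scale (z ^ t) (\<Sum>s<m. scale (inverse z ^ (t * s)) ((T ^^ s) x))"
        by (simp add: f_def scale_sum_right)
      then show ?thesis
        unfolding y_def T.scale by (simp only: scale_left_commute)
    qed
    \<comment> \<open>Orthogonality of characters: after the sums are swapped only
      \<open>s = 0\<close> survives, which gives back \<open>x\<close>.\<close>
    have orth: "(\<Sum>t<m. inverse z ^ (t * s)) = (if s = 0 then of_nat m else 0)" if "s < m" for s
    proof (cases "s = 0")
      case False
      then have "z ^ s \<noteq> 1" using z that by (auto simp: primitive_root_of_unity_def)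
      then have "inverse z ^ s \<noteq> 1" by (simp add: power_inverse)
      moreover have "(inverse z ^ s) ^ m = 1"
        by (metis inverse_1 mult.commute power_inverse power_mult power_one zm)
      moreover have "(\<Sum>t<m. inverse z ^ (t * s)) = (\<Sum>t<m. (inverse z ^ s) ^ t)"
        by (simp add: mult.commute flip: power_mult)
      ultimately show ?thesis using False by (simp add: geometric_sum)
    qed simp
    have "(\<Sum>t<m. y t) = scale (inverse (of_nat m))
        (\<Sum>s<m. scale (\<Sum>t<m. inverse z ^ (t * s)) ((T ^^ s) x))"
      unfolding y_def by (subst scale_sum_right[symmetric], subst sum.swap) (simp add: scale_sum_left)
    also have "(\<Sum>s<m. scale (\<Sum>t<m. inverse z ^ (t * s)) ((T ^^ s) x))
        = (\<Sum>s<m. if s = 0 then scale (of_nat m) x else 0)"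
      by (rule sum.cong) (auto simp: orth)
    also have "\<dots> = scale (of_nat m) x" using m by simp
    finally show "x = (\<Sum>t<m. y t)" using m0 by simp
  qed
qed

end

section \<open>Modules generated by highest weight vectors\<close>

text \<open>The relations are required on the subspace \<open>M\<close> only, since the module of
  interest, the quotient algebra, will be a subspace of a function space and not a type of its
  own.\<close>

locale clifford_module = vector_space scale
  for scale :: "'k::field \<Rightarrow> 'v::ab_group_add \<Rightarrow> 'v" (infixr "*s" 75) +
  fixes n k :: nat and q :: 'k and M :: "'v set" and act :: "gen \<Rightarrow> 'v \<Rightarrow> 'v"
  assumes two_nonzero: "(2::'k) \<noteq> 0" and q_nonzero: "q \<noteq> 0" and k_pos: "0 < k"
    and linear_act: "\<And>g. Vector_Spaces.linear scale scale (act g)"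
    and subspace_M: "subspace M"
    and act_M: "\<And>g v. g \<in> gens n \<Longrightarrow> v \<in> M \<Longrightarrow> act g v \<in> M"
    and Om_Om: "\<And>a b v. a \<in> {1..n} \<Longrightarrow> b \<in> {1..n} \<Longrightarrow> v \<in> M \<Longrightarrow>
        act (Om a) (act (Om b) v) = act (Om b) (act (Om a) v)"
    and Om_OmInv: "\<And>a v. a \<in> {1..n} \<Longrightarrow> v \<in> M \<Longrightarrow> act (Om a) (act (OmInv a) v) = v"
    and Om_Psi: "\<And>a b v. a \<in> {1..n} \<Longrightarrow> b \<in> {1..n} \<Longrightarrow> v \<in> M \<Longrightarrow>
        act (Om a) (act (Psi b) v) = (if a = b then q else 1) *s act (Psi b) (act (Om a) v)"
    and Om_PsiS: "\<And>a b v. a \<in> {1..n} \<Longrightarrow> b \<in> {1..n} \<Longrightarrow> v \<in> M \<Longrightarrow>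
        act (Om a) (act (PsiS b) v) = (if a = b then inverse q else 1) *s act (PsiS b) (act (Om a) v)"
    and Psi_Psi: "\<And>a b v. a \<in> {1..n} \<Longrightarrow> b \<in> {1..n} \<Longrightarrow> v \<in> M \<Longrightarrow>
        act (Psi a) (act (Psi b) v) = - act (Psi b) (act (Psi a) v)"
    and PsiS_PsiS: "\<And>a b v. a \<in> {1..n} \<Longrightarrow> b \<in> {1..n} \<Longrightarrow> v \<in> M \<Longrightarrow>
        act (PsiS a) (act (PsiS b) v) = - act (PsiS b) (act (PsiS a) v)"
    and OmInv_pow: "\<And>a v. a \<in> {1..n} \<Longrightarrow> v \<in> M \<Longrightarrow>
        (act (OmInv a) ^^ k) v = act (Psi a) (act (PsiS a) v) + q ^ k *s act (PsiS a) (act (Psi a) v)"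
    and Om_pow: "\<And>a v. a \<in> {1..n} \<Longrightarrow> v \<in> M \<Longrightarrow>
        (act (Om a) ^^ k) v = act (Psi a) (act (PsiS a) v) + inverse q ^ k *s act (PsiS a) (act (Psi a) v)"
    and Psi_PsiS: "\<And>a b v. a \<in> {1..n} \<Longrightarrow> b \<in> {1..n} \<Longrightarrow> a \<noteq> b \<Longrightarrow> v \<in> M \<Longrightarrow>
        act (Psi a) (act (PsiS b) v) = - act (PsiS b) (act (Psi a) v)"
begin

lemma act_linear_simps [simp]:
  "act g (x + y) = act g x + act g y" "act g (- x) = - act g x" "act g 0 = 0"
  "act g (c *s x) = c *s act g x" "act g (\<Sum>t\<in>A. f t) = (\<Sum>t\<in>A. act g (f t))"
proof -
  interpret Vector_Spaces.linear scale scale "act g" by (rule linear_act)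
  show "act g (x + y) = act g x + act g y" "act g (- x) = - act g x" "act g 0 = 0"
    "act g (c *s x) = c *s act g x" "act g (\<Sum>t\<in>A. f t) = (\<Sum>t\<in>A. act g (f t))"
    by (rule add neg zero scale sum)+
qed

lemma act_in_M [simp]:
  assumes "a \<in> {1..n}" "v \<in> M"
  shows "act (Psi a) v \<in> M" "act (PsiS a) v \<in> M" "act (Om a) v \<in> M" "act (OmInv a) v \<in> M"
  using assms by (auto intro!: act_M simp: gens_def)

lemma M_simps [simp]:
  "x \<in> M \<Longrightarrow> y \<in> M \<Longrightarrow> x + y \<in> M" "x \<in> M \<Longrightarrow> c *s x \<in> M" "x \<in> M \<Longrightarrow> - x \<in> M"
  using subspace_M by (auto intro: subspace_add subspace_scale subspace_neg)

text \<open>For equal indices the anticommutation relations only say that a vector equals its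
  negative; characteristic different from 2 turns this into vanishing squares.\<close>

lemma eq_neg_imp_zero: "x = - x \<Longrightarrow> x = 0" for x :: 'v
proof -
  assume "x = - x"
  then have "x + x = 0" by (metis add.right_inverse)
  then have "(2::'k) *s x = 0" by (metis one_add_one scale_left_distrib scale_one)
  then show "x = 0" using two_nonzero by simp
qed

lemma Psi_sq [simp]: "a \<in> {1..n} \<Longrightarrow> v \<in> M \<Longrightarrow> act (Psi a) (act (Psi a) v) = 0"
  and PsiS_sq [simp]: "a \<in> {1..n} \<Longrightarrow> v \<in> M \<Longrightarrow> act (PsiS a) (act (PsiS a) v) = 0"
  by (meson eq_neg_imp_zero Psi_Psi, meson eq_neg_imp_zero PsiS_PsiS)

lemma funpow_act_M [simp]: "g \<in> gens n \<Longrightarrow> v \<in> M \<Longrightarrow> (act g ^^ m) v \<in> M"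
  by (induction m) (auto intro: act_M)

lemma gensI [simp]: "a \<in> {1..n} \<Longrightarrow> Psi a \<in> gens n" "a \<in> {1..n} \<Longrightarrow> PsiS a \<in> gens n"
  "a \<in> {1..n} \<Longrightarrow> Om a \<in> gens n" "a \<in> {1..n} \<Longrightarrow> OmInv a \<in> gens n"
  by (auto simp: gens_def)

lemma Om_pow_OmInv_pow:
  assumes "a \<in> {1..n}" "v \<in> M"
  shows "(act (Om a) ^^ m) ((act (OmInv a) ^^ m) v) = v"
proof (induction m)
  case (Suc m)
  have "(act (Om a) ^^ Suc m) ((act (OmInv a) ^^ Suc m) v)
      = (act (Om a) ^^ m) (act (Om a) (act (OmInv a) ((act (OmInv a) ^^ m) v)))"
    by (simp add: funpow_swap1)
  then show ?case using assms Suc by (simp add: Om_OmInv)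
qed simp

text \<open>\<^verbatim>\<open>Om a\<close> commutes with the \<open>k\<close>-th power of its right inverse, as that power is a polynomial
  in \<open>\<psi>\<^sub>a\<psi>\<^sub>a\<^sup>*\<close> and \<open>\<psi>\<^sub>a\<^sup>*\<psi>\<^sub>a\<close>; hence the one-sided relation already makes it a two-sided inverse.\<close>
lemma OmInv_Om:
  assumes a: "a \<in> {1..n}" and v: "v \<in> M"
  shows "act (OmInv a) (act (Om a) v) = v"
proof -
  obtain j where k: "k = Suc j" using k_pos gr0_implies_Suc by blast
  let ?W = "act (Om a)" and ?V = "act (OmInv a)"
  have "?W ((?V ^^ k) v) = (?V ^^ k) (?W v)"
    using a v q_nonzero by (simp add: OmInv_pow Om_Psi Om_PsiS)
  moreover have "?W ((?V ^^ k) v) = (?V ^^ j) v"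
    using a v by (simp add: k Om_OmInv)
  moreover have "(?V ^^ k) (?W v) = (?V ^^ j) (?V (?W v))"
    by (simp add: k funpow_swap1)
  \<comment> \<open>The common power \<open>?V ^^ j\<close> can be cancelled, since
    \<open>?W ^^ j\<close> is a left inverse of it on \<open>M\<close>.\<close>
  ultimately have "(?W ^^ j) ((?V ^^ j) v) = (?W ^^ j) ((?V ^^ j) (?V (?W v)))" by simp
  then show ?thesis using a v by (simp add: Om_pow_OmInv_pow)
qed

text \<open>On the image of \<open>Psi a\<close> the term ending in \<open>Psi a\<close> drops out
  of both power relations, so the \<open>k\<close>-th powers of \<open>Om a\<close> and of its
  inverse agree there.\<close>

lemma Psi_image_periodic:
  assumes a: "a \<in> {1..n}" and v: "v \<in> M"
  shows "(act (Om a) ^^ (2 * k)) (act (Psi a) v) = act (Psi a) v"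
proof -
  have "(act (Om a) ^^ k) (act (Psi a) v) = (act (OmInv a) ^^ k) (act (Psi a) v)"
    using a v by (simp add: Om_pow OmInv_pow)
  then show ?thesis
    using a v by (simp add: mult_2 funpow_add Om_pow_OmInv_pow)
qed

text \<open>Multiply the two power relations: the left side is 1, the mixed terms contain a square
  of \<open>Psi a\<close> or \<open>PsiS a\<close>, and the powers of \<open>q\<close>
  cancel.\<close>

lemma one_decomposition:
  assumes a: "a \<in> {1..n}" and v: "v \<in> M"
  shows "v = act (Psi a) (act (PsiS a) (act (Psi a) (act (PsiS a) v)))
    + act (PsiS a) (act (Psi a) (act (PsiS a) (act (Psi a) v)))"
proof -
  have "v = (act (Om a) ^^ k) ((act (OmInv a) ^^ k) v)"
    using a v by (simp add: Om_pow_OmInv_pow)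
  also have "\<dots> = act (Psi a) (act (PsiS a) (act (Psi a) (act (PsiS a) v)))
    + act (PsiS a) (act (Psi a) (act (PsiS a) (act (Psi a) v)))"
    using a v q_nonzero by (simp add: Om_pow OmInv_pow power_inverse)
  finally show ?thesis .
qed

definition raise :: "nat list \<Rightarrow> 'v \<Rightarrow> 'v" where
  "raise xs v = foldr (\<lambda>a. act (PsiS a)) xs v"

lemma raise_simps [simp]: "raise [] v = v" "raise (a # xs) v = act (PsiS a) (raise xs v)"
  "raise (xs @ ys) v = raise xs (raise ys v)"
  by (simp_all add: raise_def)

lemma raise_M [simp]: "set xs \<subseteq> {1..n} \<Longrightarrow> v \<in> M \<Longrightarrow> raise xs v \<in> M"
  by (induction xs) auto

lemma raise_linear: "raise xs (x + y) = raise xs x + raise xs y"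
  "raise xs (\<Sum>t\<in>A. f t) = (\<Sum>t\<in>A. raise xs (f t))"
  by (induction xs) auto

definition highest_weight :: "nat \<Rightarrow> (nat \<Rightarrow> 'k) \<Rightarrow> 'v \<Rightarrow> bool" where
  "highest_weight m \<zeta> v \<longleftrightarrow> v \<in> M \<and> (\<forall>a\<in>{1..m}. act (Psi a) v = 0 \<and> act (Om a) v = \<zeta> a *s v)"

lemma raise_PsiS:
  assumes "set xs \<subseteq> {1..n}" "b \<in> {1..n}" "v \<in> M" "sorted xs"
  shows "act (PsiS b) (raise xs v) =
    (if b \<in> set xs then 0 else (-1) ^ length (filter (\<lambda>a. a < b) xs) *s raise (insort b xs) v)"
  using assms
proof (induction xs)
  case (Cons a xs)
  show ?case
  proof (cases "b \<le> a")
    \<comment> \<open>Here \<open>b\<close> is at most the least entry: either it goes in front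
      without a sign, or it equals the head and the square vanishes.\<close>
    case True
    then have "filter (\<lambda>a. a < b) (a # xs) = []" and "b \<in> set xs \<Longrightarrow> b = a"
      using Cons.prems by (auto simp: filter_empty_conv)
    then show ?thesis using True Cons.prems by auto
  next
    case False
    then show ?thesis using Cons by (auto simp: PsiS_PsiS[of b a])
  qed
qed simp

lemma raise_Om:
  assumes "set xs \<subseteq> {1..n}" "b \<in> {1..n}" "highest_weight n \<zeta> v" "distinct xs"
  shows "act (Om b) (raise xs v) = (\<zeta> b * (if b \<in> set xs then inverse q else 1)) *s raise xs v"
  using assms
  by (induction xs) (auto simp: highest_weight_def Om_PsiS)

lemma raise_Psi_notin:
  assumes "set xs \<subseteq> {1..n}" "b \<in> {1..n}" "highest_weight n \<zeta> v" "b \<notin> set xs"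
  shows "act (Psi b) (raise xs v) = 0"
  using assms
  by (induction xs) (auto simp: highest_weight_def Psi_PsiS)

text \<open>\<open>Psi b\<close> anticommutes past the smaller indices until it meets
  \<open>PsiS b\<close>, where the relation for the \<open>k\<close>-th power of \<open>Om b\<close>
  evaluates the pair.\<close>

lemma raise_Psi:
  assumes "set xs \<subseteq> {1..n}" "b \<in> set xs" "highest_weight n \<zeta> v" "sorted xs" "distinct xs"
  shows "act (Psi b) (raise xs v) =
    ((-1) ^ length (filter (\<lambda>a. a < b) xs) * \<zeta> b ^ k) *s raise (remove1 b xs) v"
  using assms
proof (induction xs)
  case (Cons a xs)
  have v: "v \<in> M" using Cons.prems by (simp add: highest_weight_def)
  show ?case
  proof (cases "b = a")
    case True
    then have b: "b \<in> {1..n}" "b \<notin> set xs" "set xs \<subseteq> {1..n}" "distinct xs"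
      and f: "filter (\<lambda>a. a < b) xs = []"
      using Cons.prems by (auto simp: filter_empty_conv)
    have "(act (Om b) ^^ m) (raise xs v) = \<zeta> b ^ m *s raise xs v" for m
      by (induction m) (use b raise_Om[of xs b \<zeta> v] Cons.prems in \<open>auto simp: mult.commute\<close>)
    moreover have "act (Psi b) (raise xs v) = 0"
      using raise_Psi_notin b Cons.prems by blast
    \<comment> \<open>The remaining factors do not involve \<open>b\<close>, so \<open>Psi b\<close>
      kills the vector and only one term of the power relation is left.\<close>
    ultimately have "act (Psi b) (act (PsiS b) (raise xs v)) = \<zeta> b ^ k *s raise xs v"
      using Om_pow[of b "raise xs v"] b v by simp
    then show ?thesis using True f by simp
  next
    case False
    then have "a < b" "b \<in> set xs" "b \<in> {1..n}" "a \<in> {1..n}" using Cons.prems by auto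
    then show ?thesis using Cons False v by (simp add: Psi_PsiS)
  qed
qed simp

abbreviation basis_vec :: "'v \<Rightarrow> nat set \<Rightarrow> 'v" where
  "basis_vec v S \<equiv> raise (sorted_list_of_set S) v"

lemma length_filter_sorted_list:
  "finite S \<Longrightarrow> length (filter (\<lambda>a. a < b) (sorted_list_of_set S)) = card {a \<in> S. a < b}"
  by (metis (no_types, lifting) distinct_card distinct_filter distinct_sorted_list_of_set
      set_filter set_sorted_list_of_set Collect_cong)

text \<open>The formulas hold in every module, even where the vectors are dependent or zero; this is
  what compares the quotient with the explicit matrices.\<close>

lemma act_basis_vec:
  assumes \<zeta>: "\<And>a. a \<in> {1..n} \<Longrightarrow> \<zeta> a \<noteq> 0"
    and hw: "highest_weight n \<zeta> v" and S: "S \<subseteq> {1..n}" and g: "g \<in> gens n"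
  shows "act g (basis_vec v S) = gen_coef q k \<zeta> g S *s basis_vec v (gen_move g S)"
proof -
  have fin: "finite S" using S finite_subset by blast
  have v: "v \<in> M" using hw by (simp add: highest_weight_def)
  let ?xs = "sorted_list_of_set S"
  have xs: "set ?xs \<subseteq> {1..n}" "sorted ?xs" "distinct ?xs" "set ?xs = S" using S fin by auto
  obtain b where b: "b \<in> {1..n}" and "g = Psi b \<or> g = PsiS b \<or> g = Om b \<or> g = OmInv b"
    using g by (auto simp: gens_def)
  then consider "g = Psi b" | "g = PsiS b" | "g = Om b" | "g = OmInv b" by blast
  then show ?thesis
  proof cases
    case 1
    then show ?thesis
      using raise_Psi[OF xs(1) _ hw xs(2,3), of b] raise_Psi_notin[OF xs(1) b hw] fin xs(4)
      by (simp add: jw_sign_def length_filter_sorted_list sorted_list_of_set_remove)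
  next
    case 2
    then show ?thesis
      using raise_PsiS[OF xs(1) b v xs(2)] fin xs(4)
      by (auto simp: jw_sign_def length_filter_sorted_list sorted_list_of_set_insert)
  next
    case 3
    then show ?thesis
      using raise_Om[OF xs(1) b hw xs(3)] xs(4) by simp
  next
    case 4
    let ?c = "gen_coef q k \<zeta> (Om b) S"
    have c: "?c \<noteq> 0" using \<zeta>[OF b] q_nonzero by simp
    \<comment> \<open>\<open>OmInv b\<close> is also a left inverse, so on an eigenvector of
      \<open>Om b\<close> it acts by the inverse eigenvalue.\<close>
    have "basis_vec v S = act (OmInv b) (act (Om b) (basis_vec v S))"
      using OmInv_Om[OF b] v xs by simp
    also have "act (Om b) (basis_vec v S) = ?c *s basis_vec v S"
      using raise_Om[OF xs(1) b hw xs(3)] xs(4) by simp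
    finally have "inverse ?c *s basis_vec v S = act (OmInv b) (basis_vec v S)"
      using c by (metis act_linear_simps(4) left_inverse scale_one scale_scale)
    then show ?thesis using 4 by simp
  qed
qed

lemma word_basis_vec:
  assumes "\<And>a. a \<in> {1..n} \<Longrightarrow> \<zeta> a \<noteq> 0" "highest_weight n \<zeta> v" "S \<subseteq> {1..n}" "set w \<subseteq> gens n"
  shows "foldr act w (basis_vec v S) = word_coef q k \<zeta> w S *s basis_vec v (word_move w S)"
  using assms(4)
proof (induction w)
  case (Cons g w)
  then show ?case
    using act_basis_vec[OF assms(1,2) word_move_subset[OF _ assms(3)], of w g]
    by (simp add: mult.commute)
qed simp

end

section \<open>Spanning by highest weight vectors\<close>

context clifford_module
begin

text \<open>For \<open>m = 0\<close> this is all of \<open>M\<close>; for \<open>m = n\<close> the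
  generators act on it by the explicit matrices. The induction treats one index at a time.\<close>

definition hw_vectors :: "'k \<Rightarrow> nat \<Rightarrow> 'v set" where
  "hw_vectors z m = {basis_vec v S | v S c.
     c \<in> weights (2 * k) m \<and> highest_weight m (\<lambda>a. z ^ c a) v \<and> S \<subseteq> {1..m}}"

text \<open>Write \<open>v\<close> as a vector killed by \<open>Psi a\<close> plus
  \<open>PsiS a\<close> of another such vector, then split both into eigenvectors of
  \<open>Om a\<close>.\<close>

lemma hw_vectors_step:
  assumes z: "primitive_root_of_unity (2 * k) z" and m: "Suc m \<le> n"
    and x: "x \<in> hw_vectors z m"
  shows "x \<in> span (hw_vectors z (Suc m))"
proof -
  obtain v S c where xv: "x = basis_vec v S" and c: "c \<in> weights (2 * k) m"
    and hw: "highest_weight m (\<lambda>a. z ^ c a) v" and S: "S \<subseteq> {1..m}"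
    using x by (auto simp: hw_vectors_def)
  define a where "a = Suc m"
  have a: "a \<in> {1..n}" using m by (simp add: a_def)
  have b: "b \<in> {1..n}" "b \<noteq> a" if "b \<in> {1..m}" for b using that m by (auto simp: a_def)
  have v: "v \<in> M" using hw by (simp add: highest_weight_def)
  \<comment> \<open>The conditions already achieved, together with being killed by
    \<open>Psi a\<close>. This space is stable under \<open>Om a\<close>, so the eigenvectors can be
    found inside it.\<close>
  define E where "E = {u \<in> M. act (Psi a) u = 0 \<and> (\<forall>b\<in>{1..m}. act (Psi b) u = 0 \<and> act (Om b) u = z ^ c b *s u)}"
  have sub: "subspace E"
    using subspace_M by (auto simp: E_def subspace_def scale_right_distrib mult.commute)
  have inv: "act (Om a) u \<in> E" if "u \<in> E" for u
  proof -
    have "act (Psi d) (act (Om a) u) = 0" if "d \<in> {1..n}" "act (Psi d) u = 0" for d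
    proof -
      have "(if a = d then q else 1) *s act (Psi d) (act (Om a) u) = 0"
        using that \<open>u \<in> E\<close> a by (subst Om_Psi[symmetric]) (auto simp: E_def)
      then show ?thesis using q_nonzero by (auto split: if_splits)
    qed
    then show ?thesis using that a b by (auto simp: E_def Om_Om[of _ a])
  qed
  \<comment> \<open>By \<open>one_decomposition\<close>, \<open>v\<close> is \<open>vx\<close> plus
    \<open>PsiS a\<close> applied to \<open>vy\<close>. Both are images under \<open>Psi a\<close>,
    hence killed by it and of period \<open>2 * k\<close> under \<open>Om a\<close>.\<close>
  define vx where "vx = act (Psi a) (act (PsiS a) (act (Psi a) (act (PsiS a) v)))"
  define vy where "vy = act (Psi a) (act (PsiS a) (act (Psi a) v))"
  have E: "vx \<in> E" "vy \<in> E"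
    using a b v hw unfolding E_def vx_def vy_def highest_weight_def
    by (auto simp: Psi_PsiS Psi_Psi[of _ a] Om_Psi Om_PsiS)
  have per: "(act (Om a) ^^ (2 * k)) vx = vx" "(act (Om a) ^^ (2 * k)) vy = vy"
    unfolding vx_def vy_def using a v by (auto intro!: Psi_image_periodic)
  \<comment> \<open>\<open>a\<close> exceeds all of \<open>S\<close>, so \<open>PsiS a\<close> is
    the innermost factor and acts directly on the vector, without a sign.\<close>
  have xs: "sorted_list_of_set (insert a S) = sorted_list_of_set S @ [a]"
  proof -
    have "finite S" using S finite_subset by blast
    moreover from this have "\<forall>x\<in>set (sorted_list_of_set S). x \<le> a"
      using S by (auto simp: a_def)
    then have "insort a (sorted_list_of_set S) = sorted_list_of_set S @ [a]"
      by (rule sorted_insort_is_snoc[OF sorted_sorted_list_of_set])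
    moreover have "S - {a} = S" using S by (auto simp: a_def)
    ultimately show ?thesis by (simp add: sorted_list_of_set_insert)
  qed
  have *: "basis_vec u S \<in> span (hw_vectors z (Suc m)) \<and> basis_vec u (insert a S) \<in> span (hw_vectors z (Suc m))"
    if u: "u \<in> E" "(act (Om a) ^^ (2 * k)) u = u" for u
  proof -
    obtain y where y: "u = (\<Sum>t<2*k. y t)" "\<And>t. t < 2*k \<Longrightarrow> y t \<in> E"
      "\<And>t. t < 2*k \<Longrightarrow> act (Om a) (y t) = z ^ t *s y t"
      using eigen_decomposition[OF z _ linear_act sub inv u] k_pos by auto
    have "basis_vec (y t) S' \<in> hw_vectors z (Suc m)" if t: "t < 2 * k" and S': "S' = S \<or> S' = insert a S" for t S'
    proof -
      \<comment> \<open>The eigenvalue \<open>z ^ t\<close> supplies the new exponent at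
        \<open>a\<close>.\<close>
      have "c(a := t) \<in> weights (2 * k) (Suc m)"
        using c t by (auto simp: weights_def a_def PiE_iff extensional_def)
      moreover have "highest_weight (Suc m) (\<lambda>b. z ^ (c(a := t)) b) (y t)"
        using y(2,3)[OF t] by (auto simp: highest_weight_def E_def a_def le_Suc_eq)
      moreover have "S' \<subseteq> {1..Suc m}" using S S' by (auto simp: a_def)
      ultimately show ?thesis unfolding hw_vectors_def by blast
    qed
    then show ?thesis
      unfolding y(1) raise_linear by (intro conjI span_sum span_base) auto
  qed
  have "x = basis_vec vx S + basis_vec vy (insert a S)"
    unfolding xv xs using one_decomposition[OF a v]
    by (simp add: vx_def vy_def flip: raise_linear)
  then show ?thesis using *[OF E(1) per(1)] *[OF E(2) per(2)] by (simp add: span_add)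
qed

lemma span_hw_vectors:
  assumes z: "primitive_root_of_unity (2 * k) z" and v: "v \<in> M" and "m \<le> n"
  shows "v \<in> span (hw_vectors z m)"
  using \<open>m \<le> n\<close>
proof (induction m)
  case 0
  have "v = basis_vec v {}" by simp
  then have "v \<in> hw_vectors z 0"
    unfolding hw_vectors_def weights_def highest_weight_def using v by force
  then show ?case by (rule span_base)
next
  case (Suc m)
  have "hw_vectors z m \<subseteq> span (hw_vectors z (Suc m))"
    using hw_vectors_step[OF z Suc.prems] by blast
  then have "span (hw_vectors z m) \<subseteq> span (hw_vectors z (Suc m))"
    using span_minimal subspace_span by blast
  then show ?case using Suc by auto
qed

text \<open>By linearity it suffices to test \<open>f\<close> on the spanning set
  \<open>hw_vectors z n\<close>, where its effect is read off from a column of its matrix.\<close>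

lemma annihilates_module:
  assumes z: "primitive_root_of_unity (2 * k) z"
    and f: "f \<in> FA n"
    and zero: "\<And>c T S. c \<in> weights (2 * k) n \<Longrightarrow> T \<subseteq> {1..n} \<Longrightarrow> S \<subseteq> {1..n} \<Longrightarrow>
        rep_entry q k (\<lambda>a. z ^ c a) f T S = 0"
    and v: "v \<in> M"
  shows "(\<Sum>w | f w \<noteq> 0. f w *s foldr act w v) = 0"
proof -
  define F where "F x = (\<Sum>w | f w \<noteq> 0. f w *s foldr act w x)" for x
  have foldr_lin: "foldr act w (x + y) = foldr act w x + foldr act w y"
    "foldr act w (c *s x) = c *s foldr act w x" for w x y c
    by (induction w) auto
  have "z ^ (2 * k) = 1" using z by (simp add: primitive_root_of_unity_def)
  then have z0: "z \<noteq> 0" using k_pos by (metis mult_pos_pos pos2 power_eq_0_iff zero_neq_one)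
  have "F x = 0" if "x \<in> hw_vectors z n" for x
  proof -
    obtain v S c where x: "x = basis_vec v S" and c: "c \<in> weights (2 * k) n"
      and hw: "highest_weight n (\<lambda>a. z ^ c a) v" and S: "S \<subseteq> {1..n}"
      using \<open>x \<in> hw_vectors z n\<close> by (auto simp: hw_vectors_def)
    let ?\<zeta> = "\<lambda>a. z ^ c a"
    have w: "set w \<subseteq> gens n" if "f w \<noteq> 0" for w using f that by (auto simp: FA_def)
    have "F x = (\<Sum>w | f w \<noteq> 0. (f w * word_coef q k ?\<zeta> w S) *s basis_vec v (word_move w S))"
      unfolding F_def x
      by (rule sum.cong) (use word_basis_vec[OF _ hw S] w z0 in auto)
    \<comment> \<open>Sorting by target \<open>T\<close> brings in the matrix entries; for each word
      only \<open>T = word_move w S\<close> contributes.\<close>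
    also have "\<dots> = (\<Sum>w | f w \<noteq> 0. \<Sum>T\<in>Pow {1..n}. (f w * word_entry q k ?\<zeta> w T S) *s basis_vec v T)"
    proof (rule sum.cong)
      fix w assume "w \<in> {w. f w \<noteq> 0}"
      then have "word_move w S \<in> Pow {1..n}" using w S word_move_subset by auto
      then have "(\<Sum>T\<in>Pow {1..n}. (f w * word_entry q k ?\<zeta> w T S) *s basis_vec v T)
        = (\<Sum>T\<in>Pow {1..n}. if T = word_move w S then (f w * word_coef q k ?\<zeta> w S) *s basis_vec v T else 0)"
        by (intro sum.cong) (auto simp: word_entry_def)
      also have "\<dots> = (f w * word_coef q k ?\<zeta> w S) *s basis_vec v (word_move w S)"
        using \<open>word_move w S \<in> Pow {1..n}\<close> by (subst sum.delta) auto
      finally show "(f w * word_coef q k ?\<zeta> w S) *s basis_vec v (word_move w S)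
        = (\<Sum>T\<in>Pow {1..n}. (f w * word_entry q k ?\<zeta> w T S) *s basis_vec v T)" by simp
    qed simp
    also have "\<dots> = (\<Sum>T\<in>Pow {1..n}. rep_entry q k ?\<zeta> f T S *s basis_vec v T)"
      by (subst sum.swap) (simp add: rep_entry_def scale_sum_left)
    also have "\<dots> = 0" using zero[OF c _ S] by (intro sum.neutral) auto
    finally show ?thesis .
  qed
  moreover have "F (x + y) = F x + F y" "F (c *s x) = c *s F x" for c x y
    by (simp_all add: F_def foldr_lin scale_right_distrib sum.distrib scale_sum_right mult.commute)
  then have "subspace {x. F x = 0}"
    unfolding subspace_def by simp (metis scale_zero_left)
  ultimately have "span (hw_vectors z n) \<subseteq> {x. F x = 0}"
    by (intro span_minimal) auto
  then show ?thesis using span_hw_vectors[OF z v order_refl] by (auto simp: F_def)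
qed

end

section \<open>The free algebra and the ideal of relations\<close>

declare plus_fun_apply [simp del] zero_fun_apply [simp del]
lemmas fun_apply = plus_fun_apply zero_fun_apply

text \<open>Extend a basis of \<open>I\<close> to the whole space and let \<open>p\<close> kill the
  former and fix the added vectors. The image of \<open>p\<close> then models the quotient by
  \<open>I\<close>.\<close>

lemma (in vector_space) projection_along_subspace:
  assumes I: "subspace I"
  obtains p where "Vector_Spaces.linear scale scale p" "\<And>x. p x = 0 \<longleftrightarrow> x \<in> I" "\<And>x. x - p x \<in> I"
proof -
  interpret vector_space_pair scale scale ..
  obtain B where B: "B \<subseteq> I" "independent B" "I \<subseteq> span B"
    using maximal_independent_subset by blast
  define C where "C = extend_basis B"
  have C: "independent C" "span C = UNIV" "B \<subseteq> C"
    using B(2) by (auto simp: C_def independent_extend_basis extend_basis_superset)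
  obtain p where p: "Vector_Spaces.linear scale scale p" "\<And>b. b \<in> C \<Longrightarrow> p b = (if b \<in> B then 0 else b)"
    using linear_independent_extend[OF C(1), of "\<lambda>b. if b \<in> B then 0 else b"] by blast
  interpret p: Vector_Spaces.linear scale scale p by (rule p(1))
  have z: "p x = 0" if "x \<in> I" for x
    by (rule linear_eq_0_on_span[OF p(1), of B]) (use p(2) B(3) C(3) that in auto)
  have "subspace {x. x - p x \<in> I}"
    using I unfolding subspace_def
    by (auto simp: p.add p.scale add_diff_add simp flip: scale_right_diff_distrib)
  moreover have "C \<subseteq> {x. x - p x \<in> I}"
    using p(2) B(1) I by (auto simp: subspace_0)
  ultimately have "span C \<subseteq> {x. x - p x \<in> I}" by (rule span_minimal[rotated])
  then have d: "x - p x \<in> I" for x using C(2) by auto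
  show ?thesis
    by (rule that[OF p(1) _ d]) (metis d diff_zero z)
qed

text \<open>Left multiplication by the generator \<open>g\<close> in the free algebra.\<close>

definition lgen :: "gen \<Rightarrow> (gen list \<Rightarrow> 'k::field) \<Rightarrow> gen list \<Rightarrow> 'k" where
  "lgen g v w = (case w of [] \<Rightarrow> 0 | h # w' \<Rightarrow> if h = g then v w' else 0)"

lemma fa_add_eq_plus: "fa_add f g = f + g"
  by (simp add: fa_add_def plus_fun_def)

interpretation fa: vector_space fa_smul
  by unfold_locales (auto simp: fa_smul_def fun_eq_iff fun_apply algebra_simps)

lemma linear_lgen: "Vector_Spaces.linear fa_smul fa_smul (lgen g)"
  by unfold_locales (auto simp: lgen_def fa_smul_def fun_eq_iff fun_apply split: list.split)

lemma fa_mult_lgen: "fa_mult (lgen g a) b = lgen g (fa_mult a b)"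
proof
  fix w
  show "fa_mult (lgen g a) b w = lgen g (fa_mult a b) w"
  proof (cases w)
    case (Cons h w')
    have "(\<Sum>i\<in>{0..Suc (length w')}. lgen g a (take i (h # w')) * b (drop i (h # w')))
      = (\<Sum>i\<in>{0..length w'}. lgen g a (h # take i w') * b (drop i w'))"
      by (subst sum.atLeast0_atMost_Suc_shift) (simp add: lgen_def)
    then show ?thesis using Cons by (simp add: fa_mult_def lgen_def)
  qed (simp add: fa_mult_def lgen_def)
qed

lemma fa_mult_one_left [simp]: "fa_mult fa_one f = f"
proof
  fix w
  have "(\<Sum>i\<in>{0..length w}. fa_one (take i w) * f (drop i w))
    = (\<Sum>i\<in>{0..length w}. if i = 0 then f w else 0)"
    by (rule sum.cong) (auto simp: fa_one_def)
  then show "fa_mult fa_one f w = f w" by (simp add: fa_mult_def)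
qed

lemma fa_mult_add_left: "fa_mult (f + g) h = fa_mult f h + fa_mult g h"
  and fa_mult_smul_left: "fa_mult (fa_smul c f) h = fa_smul c (fa_mult f h)"
  and fa_mult_0_left: "fa_mult 0 h = 0"
  by (auto simp: fun_eq_iff fun_apply fa_mult_def fa_smul_def distrib_right sum.distrib sum_distrib_left mult.assoc)

abbreviation fa_word :: "gen list \<Rightarrow> gen list \<Rightarrow> 'k::field" where
  "fa_word u \<equiv> foldr lgen u fa_one"

lemma fa_word_apply: "fa_word u w = (if w = u then 1 else 0)"
  by (induction u arbitrary: w) (auto simp: fa_one_def lgen_def split: list.split)

lemma fa_mult_word: "fa_mult (fa_word u) f = foldr lgen u f"
  by (induction u) (auto simp: fa_mult_lgen)

lemma lin_simps: "lin [] = 0" "lin ((c, u) # cs) = fa_smul c (fa_word u) + lin cs"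
  by (auto simp: lin_def fun_eq_iff fun_apply fa_smul_def fa_word_apply)

lemma fa_mult_lin: "fa_mult (lin cs) f = (\<Sum>(c, u)\<leftarrow>cs. fa_smul c (foldr lgen u f))"
  by (induction cs) (auto simp: lin_simps fa_mult_0_left fa_mult_add_left fa_mult_smul_left fa_mult_word)

lemma FA_I: "finite A \<Longrightarrow> {w. f w \<noteq> 0} \<subseteq> A \<Longrightarrow> (\<And>w. w \<in> A \<Longrightarrow> set w \<subseteq> gens n) \<Longrightarrow> f \<in> FA n"
  by (auto simp: FA_def intro: finite_subset)

lemma subspace_FA: "fa.subspace (FA n)"
  unfolding fa.subspace_def
proof (intro conjI ballI allI)
  fix x y :: "gen list \<Rightarrow> 'a" assume "x \<in> FA n" "y \<in> FA n"
  then show "x + y \<in> FA n"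
    by (intro FA_I[of "{w. x w \<noteq> 0} \<union> {w. y w \<noteq> 0}"]) (auto simp: FA_def fun_apply)
next
  fix c and x :: "gen list \<Rightarrow> 'a" assume "x \<in> FA n"
  then show "fa_smul c x \<in> FA n"
    by (intro FA_I[of "{w. x w \<noteq> 0}"]) (auto simp: FA_def fa_smul_def)
qed (simp add: FA_def fun_apply)

lemma lgen_FA:
  assumes "g \<in> gens n" "f \<in> FA n"
  shows "lgen g f \<in> FA n"
proof (rule FA_I)
  show "finite ((#) g ` {w. f w \<noteq> 0})" using assms by (simp add: FA_def)
  show "{w. lgen g f w \<noteq> 0} \<subseteq> (#) g ` {w. f w \<noteq> 0}"
  proof
    fix w assume "w \<in> {w. lgen g f w \<noteq> 0}"
    then show "w \<in> (#) g ` {w. f w \<noteq> 0}"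
      by (cases w) (auto simp: lgen_def split: if_splits)
  qed
  show "set w \<subseteq> gens n" if "w \<in> (#) g ` {w. f w \<noteq> 0}" for w
    using that assms unfolding FA_def by fastforce
qed

lemma foldr_lgen_FA: "set u \<subseteq> gens n \<Longrightarrow> f \<in> FA n \<Longrightarrow> foldr lgen u f \<in> FA n"
  by (induction u) (auto intro: lgen_FA)

lemma fa_one_FA: "fa_one \<in> FA n"
  by (intro FA_I[of "{[]}"]) (auto simp: fa_one_def)

lemma fa_word_FA: "set u \<subseteq> gens n \<Longrightarrow> fa_word u \<in> FA n"
  by (simp add: foldr_lgen_FA fa_one_FA)

lemma fa_mult_FA:
  assumes "f \<in> FA n" "g \<in> FA n"
  shows "fa_mult f g \<in> FA n"
proof (rule FA_I)
  let ?A = "(\<lambda>(u, v). u @ v) ` ({u. f u \<noteq> 0} \<times> {v. g v \<noteq> 0})"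
  show "finite ?A" using assms by (auto simp: FA_def)
  show "{w. fa_mult f g w \<noteq> 0} \<subseteq> ?A"
  proof clarify
    fix w assume "fa_mult f g w \<noteq> 0"
    then obtain i where "f (take i w) * g (drop i w) \<noteq> 0"
      unfolding fa_mult_def by (meson sum.neutral)
    then show "w \<in> ?A" by (intro image_eqI[of _ _ "(take i w, drop i w)"]) auto
  qed
  show "set w \<subseteq> gens n" if "w \<in> ?A" for w
    using that assms unfolding FA_def by fastforce
qed

lemma FA_expand:
  assumes "f \<in> FA n"
  shows "f = (\<Sum>w | f w \<noteq> 0. fa_smul (f w) (fa_word w))"
proof
  fix u
  have fin: "finite {w. f w \<noteq> 0}" using assms by (simp add: FA_def)
  have "(\<Sum>w | f w \<noteq> 0. fa_smul (f w) (fa_word w)) u = (\<Sum>w | f w \<noteq> 0. fa_smul (f w) (fa_word w) u)"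
    using fin by (induction rule: finite_induct) (auto simp: fun_apply)
  also have "\<dots> = (\<Sum>w | f w \<noteq> 0. if w = u then f u else 0)"
    by (rule sum.cong) (auto simp: fa_smul_def fa_word_apply)
  also have "\<dots> = f u" using fin by (simp add: sum.delta')
  finally show "f u = (\<Sum>w | f w \<noteq> 0. fa_smul (f w) (fa_word w)) u" by simp
qed

lemma cl_rels_lin:
  assumes "r \<in> cl_rels n k q"
  obtains cs where "r = lin cs" "\<And>c u. (c, u) \<in> set cs \<Longrightarrow> set u \<subseteq> gens n"
proof -
  have "\<exists>cs. r = lin cs \<and> (\<forall>(c, u)\<in>set cs. set u \<subseteq> gens n)"
    using assms unfolding cl_rels_def
    apply (elim UnE CollectE exE conjE)
    apply (rule exI, rule conjI, assumption, force simp: gens_def)+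
    done
  then obtain cs where "r = lin cs" "\<forall>(c, u)\<in>set cs. set u \<subseteq> gens n" by blast
  then show ?thesis by (intro that[of cs]) auto
qed

lemma cl_rels_FA: "cl_rels n k q \<subseteq> FA n"
proof
  fix r assume "r \<in> cl_rels n k q"
  then obtain cs where "r = lin cs" "\<And>c u. (c, u) \<in> set cs \<Longrightarrow> set u \<subseteq> gens n"
    by (rule cl_rels_lin) blast
  moreover have "(\<And>c u. (c, u) \<in> set cs \<Longrightarrow> set u \<subseteq> gens n) \<Longrightarrow> lin cs \<in> FA n" for cs :: "('a \<times> gen list) list"
  proof (induction cs)
    case (Cons x cs)
    obtain c u where x: "x = (c, u)" by fastforce
    then show ?case using Cons
      by (auto simp: lin_simps intro!: fa.subspace_add[OF subspace_FA] fa.subspace_scale[OF subspace_FA] fa_word_FA)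
  qed (simp add: lin_simps fa.subspace_0[OF subspace_FA])
  ultimately show "r \<in> FA n" by simp
qed

lemma cl_ideal_FA: "x \<in> cl_ideal n k q \<Longrightarrow> x \<in> FA n"
proof (induction rule: cl_ideal.induct)
  case zero
  then show ?case by (simp add: FA_def)
next
  case (rel r a b)
  then show ?case using cl_rels_FA by (blast intro: fa_mult_FA)
next
  case (add x y)
  then show ?case by (simp add: fa_add_eq_plus fa.subspace_add[OF subspace_FA])
qed

text \<open>Scaling is not among the rules generating the ideal; a scalar is absorbed into the left
  factor of each generating product.\<close>

lemma subspace_cl_ideal: "fa.subspace (cl_ideal n k q)"
  unfolding fa.subspace_def
proof (intro conjI ballI allI)
  show "0 \<in> cl_ideal n k q" using cl_ideal.zero by (simp add: zero_fun_def)
  show "x + y \<in> cl_ideal n k q" if "x \<in> cl_ideal n k q" "y \<in> cl_ideal n k q" for x y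
    using cl_ideal.add[OF that] by (simp add: fa_add_eq_plus)
  show "fa_smul c x \<in> cl_ideal n k q" if "x \<in> cl_ideal n k q" for c x
    using that
  proof (induction rule: cl_ideal.induct)
    case zero
    then show ?case using cl_ideal.zero by (simp add: fa_smul_def)
  next
    case (rel r a b)
    then have "fa_mult (fa_mult (fa_smul c a) r) b \<in> cl_ideal n k q"
      using subspace_FA by (intro cl_ideal.rel) (auto intro: fa.subspace_scale)
    then show ?case by (simp add: fa_mult_smul_left)
  next
    case (add x y)
    then show ?case using cl_ideal.add by (fastforce simp: fa_add_eq_plus fa.scale_right_distrib)
  qed
qed

text \<open>Likewise absorbed into the left factor. This makes the action of the generators on the
  quotient well defined.\<close>

lemma lgen_cl_ideal:
  fixes q :: "'k::field"
  assumes "g \<in> gens n" "x \<in> cl_ideal n k q"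
  shows "lgen g x \<in> cl_ideal n k q"
  using assms(2)
proof (induction rule: cl_ideal.induct)
  case zero
  have "lgen g (\<lambda>_. 0 :: 'k) = (\<lambda>_. 0)" by (auto simp: lgen_def fun_eq_iff split: list.split)
  then show ?case using cl_ideal.zero by simp
next
  case (rel r a b)
  then have "fa_mult (fa_mult (lgen g a) r) b \<in> cl_ideal n k q"
    using assms(1) by (intro cl_ideal.rel lgen_FA)
  then show ?case by (simp add: fa_mult_lgen)
next
  case (add x y)
  have "lgen g (fa_add x y) = fa_add (lgen g x) (lgen g y)"
    by (auto simp: lgen_def fa_add_def fun_eq_iff split: list.split)
  then show ?case using add cl_ideal.add by auto
qed

text \<open>The quotient by the ideal depends on \<open>n\<close>, \<open>k\<close> and \<open>q\<close> and so cannot be a type; it is realised inside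
  the function space as the image of a linear projection whose kernel is the ideal.\<close>
lemma kernel_subset_cl_ideal:
  fixes q z :: "'k::field"
  assumes two: "(2::'k) \<noteq> 0" and q: "q \<noteq> 0" and k: "0 < k"
    and z: "primitive_root_of_unity (2 * k) z" and f: "f \<in> FA n"
    and zero: "\<And>c T S. c \<in> weights (2 * k) n \<Longrightarrow> T \<subseteq> {1..n} \<Longrightarrow> S \<subseteq> {1..n} \<Longrightarrow>
        rep_entry q k (\<lambda>a. z ^ c a) f T S = 0"
  shows "f \<in> cl_ideal n k q"
proof -
  obtain p where p: "Vector_Spaces.linear fa_smul fa_smul p" and ker: "\<And>x. p x = 0 \<longleftrightarrow> x \<in> cl_ideal n k q"
    and diff: "\<And>x. x - p x \<in> cl_ideal n k q"
    using fa.projection_along_subspace[OF subspace_cl_ideal] by blast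
  interpret p: Vector_Spaces.linear fa_smul fa_smul p by (rule p)
  \<comment> \<open>A generator acts by left multiplication followed by projection to the chosen
    representatives, which form \<open>M\<close>.\<close>
  define act where "act g v = p (lgen g v)" for g v
  define M where "M = p ` FA n"
  have act_add: "act g (x + y) = act g x + act g y"
    and act_smul: "act g (fa_smul c x) = fa_smul c (act g x)" for g x y c
  proof -
    interpret l: Vector_Spaces.linear fa_smul fa_smul "lgen g" by (rule linear_lgen)
    show "act g (x + y) = act g x + act g y" "act g (fa_smul c x) = fa_smul c (act g x)"
      by (simp_all add: act_def l.add l.scale p.add p.scale)
  qed
  have p_FA: "p x \<in> FA n" if "x \<in> FA n" for x
  proof -
    have "x - (x - p x) \<in> FA n"
      using fa.subspace_diff[OF subspace_FA that cl_ideal_FA[OF diff]] by blast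
    then show ?thesis by simp
  qed
  have pp: "p (p x) = p x" for x using diff[of x] by (simp add: p.diff flip: ker)
  have M: "v \<in> FA n \<and> p v = v" if "v \<in> M" for v
    using that p_FA pp by (auto simp: M_def)
  \<comment> \<open>The ideal is stable under left multiplication, so the choice of representative
    does not matter; hence words act through products in the free algebra.\<close>
  have p_lgen: "p (lgen g (p x)) = p (lgen g x)" if "g \<in> gens n" for g x
  proof -
    interpret l: Vector_Spaces.linear fa_smul fa_smul "lgen g" by (rule linear_lgen)
    have "p (lgen g (x - p x)) = 0" unfolding ker using that diff by (rule lgen_cl_ideal)
    then show ?thesis by (simp add: l.diff p.diff)
  qed
  have act_word: "foldr act u (p x) = p (foldr lgen u x)" if "set u \<subseteq> gens n" for u x
    using that by (induction u) (auto simp: act_def p_lgen)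
  have rel: "(\<Sum>(c, u)\<leftarrow>cs. fa_smul c (foldr act u v)) = 0"
    if r: "lin cs \<in> cl_rels n k q" and cs: "\<forall>(c, u)\<in>set cs. set u \<subseteq> gens n" and v: "v \<in> M" for cs v
  proof -
    \<comment> \<open>A relation times \<open>v\<close> lies in the ideal, so the relation holds for
      the action on \<open>v\<close>.\<close>
    have "fa_mult (fa_mult fa_one (lin cs)) v \<in> cl_ideal n k q"
      using r fa_one_FA M[OF v] by (intro cl_ideal.rel) auto
    then have "p (\<Sum>(c, u)\<leftarrow>cs. fa_smul c (foldr lgen u v)) = 0"
      by (simp add: ker fa_mult_lin)
    moreover have "p (\<Sum>(c, u)\<leftarrow>cs. fa_smul c (foldr lgen u v)) = (\<Sum>(c, u)\<leftarrow>cs. fa_smul c (foldr act u v))"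
      using cs
    proof (induction cs)
      case (Cons x cs)
      then show ?case
        using act_word[of "snd x" v] M[OF v] by (auto simp: p.add p.scale split: prod.splits)
    qed (simp add: p.zero)
    ultimately show ?thesis by simp
  qed
  have rel2: "foldr act u v = fa_smul c (foldr act u' v)"
    if "lin [(1, u), (- c, u')] \<in> cl_rels n k q" "set u \<subseteq> gens n" "set u' \<subseteq> gens n" "v \<in> M" for u u' c v
    using rel[OF that(1) _ that(4)] that(2,3) by simp
  have rel3: "foldr act u'' v = foldr act u v + fa_smul c (foldr act u' v)"
    if "lin [(1, u), (c, u'), (- 1, u'')] \<in> cl_rels n k q"
      "set u \<subseteq> gens n" "set u' \<subseteq> gens n" "set u'' \<subseteq> gens n" "v \<in> M" for u u' u'' c v
    using rel[OF that(1) _ that(5)] that(2-4) by (simp add: add_diff_eq)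
  have g: "Psi a \<in> gens n" "PsiS a \<in> gens n" "Om a \<in> gens n" "OmInv a \<in> gens n" if "a \<in> {1..n}" for a
    using that by (auto simp: gens_def)
  have rep: "foldr act (replicate m h) v = (act h ^^ m) v" for m h v
    by (induction m) auto
  interpret clifford_module fa_smul n k q M act
  proof
    show "fa.subspace M" unfolding M_def
      using p.subspace_image[OF subspace_FA] .
    show "act g v \<in> M" if "g \<in> gens n" "v \<in> M" for g v
      using that M unfolding M_def act_def by (blast intro: lgen_FA)
    fix a b v assume a: "a \<in> {1..n}" and v: "v \<in> M"
    have "lin [(1, [Om a, OmInv a]), (-1, [])] \<in> cl_rels n k q"
      using a unfolding cl_rels_def by blast
    from rel2[OF this] show "act (Om a) (act (OmInv a) v) = v"
      using a g v by simp
    have "lin [(1, [Psi a, PsiS a]), (q ^ k, [PsiS a, Psi a]), (-1, replicate k (OmInv a))] \<in> cl_rels n k q"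
      using a unfolding cl_rels_def by blast
    from rel3[OF this] show "(act (OmInv a) ^^ k) v
        = act (Psi a) (act (PsiS a) v) + fa_smul (q ^ k) (act (PsiS a) (act (Psi a) v))"
      using a g v k by (simp add: rep)
    have "lin [(1, [Psi a, PsiS a]), (inverse q ^ k, [PsiS a, Psi a]), (-1, replicate k (Om a))] \<in> cl_rels n k q"
      using a unfolding cl_rels_def by blast
    from rel3[OF this] show "(act (Om a) ^^ k) v
        = act (Psi a) (act (PsiS a) v) + fa_smul (inverse q ^ k) (act (PsiS a) (act (Psi a) v))"
      using a g v k by (simp add: rep)
    assume b: "b \<in> {1..n}"
    have "lin [(1, [Om a, Om b]), (- 1, [Om b, Om a])] \<in> cl_rels n k q"
      using a b unfolding cl_rels_def by blast
    from rel2[OF this] show "act (Om a) (act (Om b) v) = act (Om b) (act (Om a) v)"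
      using a b g v by simp
    have "lin [(1, [Om a, Psi b]), (- (if a = b then q else 1), [Psi b, Om a])] \<in> cl_rels n k q"
      using a b unfolding cl_rels_def by blast
    from rel2[OF this] show "act (Om a) (act (Psi b) v) = fa_smul (if a = b then q else 1) (act (Psi b) (act (Om a) v))"
      using a b g v by simp
    have "lin [(1, [Om a, PsiS b]), (- (if a = b then inverse q else 1), [PsiS b, Om a])] \<in> cl_rels n k q"
      using a b unfolding cl_rels_def by blast
    from rel2[OF this] show "act (Om a) (act (PsiS b) v) = fa_smul (if a = b then inverse q else 1) (act (PsiS b) (act (Om a) v))"
      using a b g v by simp
    have "lin [(1, [Psi a, Psi b]), (1, [Psi b, Psi a])] \<in> cl_rels n k q"
      using a b unfolding cl_rels_def by blast
    \<comment> \<open>\<open>rel2\<close> expects the second coefficient in the form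
      \<open>- c\<close>; anticommutation is the case \<open>c = -1\<close>.\<close>
    from rel2[of _ "-1", unfolded minus_minus, OF this]
    show "act (Psi a) (act (Psi b) v) = - act (Psi b) (act (Psi a) v)"
      using a b g v by simp
    have "lin [(1, [PsiS a, PsiS b]), (1, [PsiS b, PsiS a])] \<in> cl_rels n k q"
      using a b unfolding cl_rels_def by blast
    from rel2[of _ "-1", unfolded minus_minus, OF this]
    show "act (PsiS a) (act (PsiS b) v) = - act (PsiS b) (act (PsiS a) v)"
      using a b g v by simp
    assume "a \<noteq> b"
    then have "lin [(1, [Psi a, PsiS b]), (1, [PsiS b, Psi a])] \<in> cl_rels n k q"
      using a b unfolding cl_rels_def by blast
    from rel2[of _ "-1", unfolded minus_minus, OF this]
    show "act (Psi a) (act (PsiS b) v) = - act (PsiS b) (act (Psi a) v)"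
      using a b g v by simp
  qed (use two q k in \<open>auto simp: act_add act_smul\<close>)
  \<comment> \<open>The class of \<open>f\<close> is \<open>f\<close> acting on the class of the
    unit, and an element with zero matrices annihilates the module.\<close>
  have "p f = p (\<Sum>w | f w \<noteq> 0. fa_smul (f w) (fa_word w))"
    using FA_expand[OF f] by simp
  also have "\<dots> = (\<Sum>w | f w \<noteq> 0. fa_smul (f w) (p (fa_word w)))"
    by (simp add: p.sum p.scale)
  also have "\<dots> = (\<Sum>w | f w \<noteq> 0. fa_smul (f w) (foldr act w (p fa_one)))"
    by (rule sum.cong) (use f act_word in \<open>auto simp: FA_def\<close>)
  also have "\<dots> = 0"
    using annihilates_module[OF z f zero] imageI[OF fa_one_FA, of p n] by (simp add: M_def)
  finally show ?thesis by (simp add: ker)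
qed

section \<open>The matrix representation\<close>

lemma rep_entry_superset:
  "finite A \<Longrightarrow> {w. f w \<noteq> 0} \<subseteq> A \<Longrightarrow> rep_entry q k \<zeta> f T S = (\<Sum>w\<in>A. f w * word_entry q k \<zeta> w T S)"
  unfolding rep_entry_def by (rule sum.mono_neutral_left) auto

lemma rep_entry_0 [simp]: "rep_entry q k \<zeta> 0 T S = 0"
  by (simp add: rep_entry_def fun_apply)

lemma rep_entry_add:
  assumes "f \<in> FA n" "g \<in> FA n"
  shows "rep_entry q k \<zeta> (f + g) T S = rep_entry q k \<zeta> f T S + rep_entry q k \<zeta> g T S"
proof -
  let ?A = "{w. f w \<noteq> 0} \<union> {w. g w \<noteq> 0}"
  have "finite ?A" using assms by (simp add: FA_def)
  then have "rep_entry q k \<zeta> f T S = (\<Sum>w\<in>?A. f w * word_entry q k \<zeta> w T S)"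
    "rep_entry q k \<zeta> g T S = (\<Sum>w\<in>?A. g w * word_entry q k \<zeta> w T S)"
    "rep_entry q k \<zeta> (f + g) T S = (\<Sum>w\<in>?A. (f + g) w * word_entry q k \<zeta> w T S)"
    by - (rule rep_entry_superset; force simp: fun_apply)+
  then show ?thesis by (simp add: fun_apply distrib_right sum.distrib)
qed

lemma rep_entry_smul:
  assumes "f \<in> FA n"
  shows "rep_entry q k \<zeta> (fa_smul c f) T S = c * rep_entry q k \<zeta> f T S"
proof -
  have "rep_entry q k \<zeta> (fa_smul c f) T S = (\<Sum>w | f w \<noteq> 0. fa_smul c f w * word_entry q k \<zeta> w T S)"
    using assms by (intro rep_entry_superset) (auto simp: FA_def fa_smul_def)
  then show ?thesis by (simp add: rep_entry_def fa_smul_def sum_distrib_left mult.assoc)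
qed

lemma rep_entry_sum:
  assumes "\<And>x. x \<in> A \<Longrightarrow> F x \<in> FA n"
  shows "rep_entry q k \<zeta> (\<Sum>x\<in>A. F x) T S = (\<Sum>x\<in>A. rep_entry q k \<zeta> (F x) T S)"
  using assms
proof (induction A rule: infinite_finite_induct)
  case (insert x A)
  have "(\<Sum>x\<in>A. F x) \<in> FA n"
    by (rule fa.subspace_sum[OF subspace_FA]) (use insert.prems in auto)
  then show ?case using insert by (simp add: rep_entry_add[of "F x" n "\<Sum>x\<in>A. F x"])
qed simp_all

lemma rep_entry_word: "rep_entry q k \<zeta> (fa_word u) T S = word_entry q k \<zeta> u T S"
  by (subst rep_entry_superset[of "{u}"]) (auto simp: fa_word_apply)

lemma rep_entry_lin:
  fixes q :: "'k::field"
  assumes "\<forall>(c, u)\<in>set cs. set u \<subseteq> gens n"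
  shows "lin cs \<in> FA n \<and> rep_entry q k \<zeta> (lin cs) T S = (\<Sum>(c, u)\<leftarrow>cs. c * word_entry q k \<zeta> u T S)"
  using assms
proof (induction cs)
  case (Cons x cs)
  obtain c u where x: "x = (c, u)" by fastforce
  have "(fa_word u :: gen list \<Rightarrow> 'k) \<in> FA n" using Cons.prems x by (simp add: fa_word_FA)
  then show ?case
    using Cons x
    by (simp add: lin_simps fa.subspace_add[OF subspace_FA] fa.subspace_scale[OF subspace_FA] rep_entry_add[of _ n] rep_entry_smul[of _ n] rep_entry_word)
qed (simp add: lin_simps fa.subspace_0[OF subspace_FA])

lemma word_coef_append: "word_coef q k \<zeta> (u @ v) S = word_coef q k \<zeta> u (word_move v S) * word_coef q k \<zeta> v S"
  by (induction u) auto

text \<open>The column of \<open>v\<close> at \<open>S\<close> is supported at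
  \<open>word_move v S\<close>, so the sum collapses to one term.\<close>

lemma word_entry_append:
  assumes "set v \<subseteq> gens n" "S \<subseteq> {1..n}"
  shows "word_entry q k \<zeta> (u @ v) T S = (\<Sum>U\<in>Pow {1..n}. word_entry q k \<zeta> u T U * word_entry q k \<zeta> v U S)"
proof -
  have "(\<Sum>U\<in>Pow {1..n}. word_entry q k \<zeta> u T U * word_entry q k \<zeta> v U S)
    = (\<Sum>U\<in>Pow {1..n}. if U = word_move v S then word_entry q k \<zeta> u T U * word_coef q k \<zeta> v S else 0)"
    by (rule sum.cong) (auto simp: word_entry_def)
  also have "\<dots> = word_entry q k \<zeta> u T (word_move v S) * word_coef q k \<zeta> v S"
    using word_move_subset[OF assms] by (simp add: sum.delta)
  finally show ?thesis by (auto simp: word_entry_def word_coef_append)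
qed

text \<open>Cutting positions in \<open>w\<close> correspond bijectively to factorisations of
  \<open>w\<close> into two words.\<close>

lemma fa_mult_pairs:
  assumes "f \<in> FA n" "g \<in> FA n"
  shows "fa_mult f g w = (\<Sum>u | f u \<noteq> 0. \<Sum>v | g v \<noteq> 0. if u @ v = w then f u * g v else 0)"
proof -
  have fin: "finite {u. f u \<noteq> 0}" "finite {v. g v \<noteq> 0}" using assms by (auto simp: FA_def)
  let ?P = "(\<lambda>i. (take i w, drop i w)) ` {0..length w}"
  have inj: "inj_on (\<lambda>i. (take i w, drop i w)) {0..length w}"
    by (rule inj_onI) (auto dest!: arg_cong[where f=length] simp: min_def split: if_splits)
  have P: "(u, v) \<in> ?P \<longleftrightarrow> u @ v = w" for u v
  proof
    assume "u @ v = w"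
    then show "(u, v) \<in> ?P" by (intro image_eqI[of _ _ "length u"]) auto
  qed auto
  let ?Q = "{u. f u \<noteq> 0} \<times> {v. g v \<noteq> 0}"
  have "fa_mult f g w = (\<Sum>(u, v)\<in>?P. f u * g v)"
    unfolding fa_mult_def by (subst sum.reindex[OF inj]) simp
  also have "\<dots> = (\<Sum>(u, v)\<in>?P \<inter> ?Q. f u * g v)"
    by (rule sum.mono_neutral_right) auto
  also have "\<dots> = (\<Sum>(u, v)\<in>?Q. if (u, v) \<in> ?P then f u * g v else 0)"
    using fin by (subst Int_commute, subst sum.inter_restrict) (auto intro!: sum.cong)
  also have "\<dots> = (\<Sum>u | f u \<noteq> 0. \<Sum>v | g v \<noteq> 0. if (u, v) \<in> ?P then f u * g v else 0)"
    by (simp add: sum.cartesian_product)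
  finally show ?thesis unfolding P .
qed

text \<open>Expand the product over pairs of words; \<open>word_entry_append\<close> turns
  concatenation into a matrix product, and the sums are interchanged.\<close>

lemma rep_entry_mult:
  assumes f: "f \<in> FA n" and g: "g \<in> FA n" and S: "S \<subseteq> {1..n}"
  shows "rep_entry q k \<zeta> (fa_mult f g) T S = (\<Sum>U\<in>Pow {1..n}. rep_entry q k \<zeta> f T U * rep_entry q k \<zeta> g U S)"
proof -
  let ?F = "{u. f u \<noteq> 0}" and ?G = "{v. g v \<noteq> 0}"
  have fin: "finite ?F" "finite ?G" using assms by (auto simp: FA_def)
  have G: "set v \<subseteq> gens n" if "v \<in> ?G" for v using that g by (auto simp: FA_def)
  let ?A = "(\<lambda>(u, v). u @ v) ` (?F \<times> ?G)"
  let ?h = "\<lambda>w. word_entry q k \<zeta> w T S"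
  have A: "finite ?A" using fin by simp
  have "{w. fa_mult f g w \<noteq> 0} \<subseteq> ?A"
  proof clarify
    fix w assume "fa_mult f g w \<noteq> 0"
    then have "\<not> (\<forall>u\<in>?F. \<forall>v\<in>?G. u @ v \<noteq> w)"
      unfolding fa_mult_pairs[OF f g] by (fastforce intro!: sum.neutral)
    then obtain u v where "u \<in> ?F" "v \<in> ?G" "u @ v = w" by blast
    then show "w \<in> ?A" by force
  qed
  then have "rep_entry q k \<zeta> (fa_mult f g) T S = (\<Sum>w\<in>?A. fa_mult f g w * ?h w)"
    by (rule rep_entry_superset[OF A])
  also have "\<dots> = (\<Sum>w\<in>?A. \<Sum>u\<in>?F. \<Sum>v\<in>?G. if w = u @ v then f u * g v * ?h w else 0)"
    unfolding fa_mult_pairs[OF f g] sum_distrib_right by (intro sum.cong refl) auto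
  also have "\<dots> = (\<Sum>u\<in>?F. \<Sum>w\<in>?A. \<Sum>v\<in>?G. if w = u @ v then f u * g v * ?h w else 0)"
    by (rule sum.swap)
  also have "\<dots> = (\<Sum>u\<in>?F. \<Sum>v\<in>?G. \<Sum>w\<in>?A. if w = u @ v then f u * g v * ?h w else 0)"
    by (intro sum.cong refl sum.swap)
  also have "\<dots> = (\<Sum>u\<in>?F. \<Sum>v\<in>?G. f u * g v * ?h (u @ v))"
  proof (intro sum.cong refl)
    fix u v assume "u \<in> ?F" "v \<in> ?G"
    then have "u @ v \<in> ?A" by force
    then show "(\<Sum>w\<in>?A. if w = u @ v then f u * g v * ?h w else 0) = f u * g v * ?h (u @ v)"
      using A by (simp only: sum.delta if_True)
  qed
  also have "\<dots> = (\<Sum>u\<in>?F. \<Sum>v\<in>?G. \<Sum>U\<in>Pow {1..n}.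
      (f u * word_entry q k \<zeta> u T U) * (g v * word_entry q k \<zeta> v U S))"
    by (intro sum.cong refl) (simp add: word_entry_append[OF G S] sum_distrib_left ac_simps)
  also have "\<dots> = (\<Sum>u\<in>?F. \<Sum>U\<in>Pow {1..n}. \<Sum>v\<in>?G.
      (f u * word_entry q k \<zeta> u T U) * (g v * word_entry q k \<zeta> v U S))"
    by (intro sum.cong refl sum.swap)
  also have "\<dots> = (\<Sum>U\<in>Pow {1..n}. \<Sum>u\<in>?F. \<Sum>v\<in>?G.
      (f u * word_entry q k \<zeta> u T U) * (g v * word_entry q k \<zeta> v U S))"
    by (rule sum.swap)
  finally show ?thesis by (simp add: rep_entry_def sum_product)
qed

lemma jw_sign_insert:
  assumes "finite S"
  shows "jw_sign a (insert b S) = (if b \<notin> S \<and> b < a then - jw_sign a S else jw_sign a S :: 'k::field)"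
proof -
  have "{x \<in> insert b S. x < a} = (if b < a then insert b {x \<in> S. x < a} else {x \<in> S. x < a})" by auto
  then show ?thesis using assms by (auto simp: jw_sign_def insert_absorb)
qed

lemma jw_sign_remove:
  assumes "finite S"
  shows "jw_sign a (S - {b}) = (if b \<in> S \<and> b < a then - jw_sign a S else jw_sign a S :: 'k::field)"
proof (cases "b \<in> S")
  case True
  then have "insert b (S - {b}) = S" by blast
  then show ?thesis
    using jw_sign_insert[of "S - {b}" a b, where 'k = 'k] assms True by (auto split: if_splits)
qed simp

lemma jw_sign_sq [simp]: "jw_sign a S * jw_sign a S = (1 :: 'k::field)"
  by (simp add: jw_sign_def flip: power_mult_distrib)

lemma funpow_fixed: "f x = x \<Longrightarrow> (f ^^ m) x = x"
  by (induction m) auto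

lemma word_coef_replicate:
  "gen_move g S = S \<Longrightarrow> word_coef q k \<zeta> (replicate m g) S = gen_coef q k \<zeta> g S ^ m"
  by (induction m) (simp_all add: funpow_fixed)

text \<open>The condition on \<open>\<zeta>\<close> reconciles the two power relations: where
  \<open>a\<close> is absent from \<open>S\<close>, the product of \<open>Psi a\<close> and
  \<open>PsiS a\<close> must equal both \<open>\<zeta> a ^ k\<close> and its inverse.\<close>

lemma rep_entry_cl_rels:
  assumes q: "q \<noteq> 0" and \<zeta>: "\<And>a. a \<in> {1..n} \<Longrightarrow> \<zeta> a ^ k * \<zeta> a ^ k = 1" "0 < k"
    and S: "S \<subseteq> {1..n}" and r: "r \<in> cl_rels n k q"
  shows "rep_entry q k \<zeta> r T S = 0"
proof -
  have fin: "finite S" using S finite_subset by blast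
  have inv: "inverse (\<zeta> a) ^ k = \<zeta> a ^ k" if "a \<in> {1..n}" for a
    using \<zeta>(1)[OF that] by (simp add: power_inverse inverse_unique)
  have nz: "\<zeta> a \<noteq> 0" if "a \<in> {1..n}" for a
    using \<zeta>(1)[OF that] \<zeta>(2) by (auto simp: power_0_left)
  have R: "rep_entry q k \<zeta> (lin cs) T S = (\<Sum>(c, u)\<leftarrow>cs. c * word_entry q k \<zeta> u T S)"
    if "\<forall>(c, u)\<in>set cs. set u \<subseteq> gens n" for cs
    using rep_entry_lin[OF that] by blast
  note [simp] = jw_sign_insert jw_sign_remove fin word_entry_def
  from r show ?thesis
    unfolding cl_rels_def
  proof (elim UnE CollectE exE conjE)
    fix a b assume "r = lin [(1, [Om a, Om b]), (- 1, [Om b, Om a])]" "a \<in> {1..n}" "b \<in> {1..n}"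
    then show ?thesis by (auto simp: R gens_def)
  next
    fix a assume "r = lin [(1, [Om a, OmInv a]), (- 1, [])]" "a \<in> {1..n}"
    then show ?thesis using nz q by (auto simp: R gens_def field_simps)
  next
    fix a b assume "r = lin [(1, [Om a, Psi b]), (- (if a = b then q else 1), [Psi b, Om a])]" "a \<in> {1..n}" "b \<in> {1..n}"
    then show ?thesis using q by (auto simp: R gens_def)
  next
    fix a b assume "r = lin [(1, [Om a, PsiS b]), (- (if a = b then inverse q else 1), [PsiS b, Om a])]" "a \<in> {1..n}" "b \<in> {1..n}"
    then show ?thesis using q by (auto simp: R gens_def)
  next
    fix a b assume "r = lin [(1, [Psi a, Psi b]), (1, [Psi b, Psi a])]" "a \<in> {1..n}" "b \<in> {1..n}"
    then show ?thesis by (auto simp: R gens_def)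
  next
    fix a b assume "r = lin [(1, [PsiS a, PsiS b]), (1, [PsiS b, PsiS a])]" "a \<in> {1..n}" "b \<in> {1..n}"
    then show ?thesis by (auto simp: R gens_def)
  next
    fix a assume "r = lin [(1, [Psi a, PsiS a]), (q ^ k, [PsiS a, Psi a]), (-1, replicate k (OmInv a))]" "a \<in> {1..n}"
    then show ?thesis using q inv \<zeta>(2) by (auto simp: R gens_def funpow_fixed word_coef_replicate power_mult_distrib power_inverse)
  next
    fix a assume "r = lin [(1, [Psi a, PsiS a]), (inverse q ^ k, [PsiS a, Psi a]), (-1, replicate k (Om a))]" "a \<in> {1..n}"
    then show ?thesis using q inv \<zeta>(2) by (auto simp: R gens_def funpow_fixed word_coef_replicate power_mult_distrib power_inverse)
  next
    fix a b assume "r = lin [(1, [Psi a, PsiS b]), (1, [PsiS b, Psi a])]" "a \<in> {1..n}" "b \<in> {1..n}" "a \<noteq> b"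
    then show ?thesis by (auto simp: R gens_def)
  qed
qed

text \<open>Lagrange interpolation: multiply one factor for each point of \<open>Y\<close>,
  normalised at \<open>x0\<close> and vanishing at that point.\<close>

lemma separating_subalgebra_indicator:
  fixes D :: "('x \<Rightarrow> 'k::field) set"
  assumes one: "(\<lambda>_. 1) \<in> D"
    and add: "\<And>d e. d \<in> D \<Longrightarrow> e \<in> D \<Longrightarrow> (\<lambda>x. d x + e x) \<in> D"
    and smul: "\<And>c d. d \<in> D \<Longrightarrow> (\<lambda>x. c * d x) \<in> D"
    and mult: "\<And>d e. d \<in> D \<Longrightarrow> e \<in> D \<Longrightarrow> (\<lambda>x. d x * e x) \<in> D"
    and sep: "\<And>y. y \<in> Y \<Longrightarrow> \<exists>d\<in>D. d x0 \<noteq> d y"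
    and "finite Y"
  shows "\<exists>d\<in>D. d x0 = 1 \<and> (\<forall>y\<in>Y. d y = 0)"
  using \<open>finite Y\<close> sep
proof (induction Y rule: finite_induct)
  case empty
  then show ?case using one by auto
next
  case (insert y Y)
  then obtain d where d: "d \<in> D" "d x0 = 1" "\<forall>y\<in>Y. d y = 0" by auto
  obtain e where e: "e \<in> D" "e x0 \<noteq> e y" using insert.prems by auto
  \<comment> \<open>The constant is written as a multiple of the function 1, so that the closure
    rules apply.\<close>
  let ?e = "\<lambda>x. inverse (e x0 - e y) * (e x + (- e y) * 1)"
  have "?e \<in> D" by (intro smul add e one)
  then have "(\<lambda>x. d x * ?e x) \<in> D" by (rule mult[OF d(1)])
  moreover have "d x0 * ?e x0 = 1" "\<forall>u\<in>insert y Y. d u * ?e u = 0"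
    using d e(2) by auto
  ultimately show ?case by (intro bexI[where x = "\<lambda>x. d x * ?e x"]) auto
qed

section \<open>The representations of all weights together\<close>

locale clifford_rep =
  fixes q z :: "'k::field" and n k :: nat
  assumes q_nonzero: "q \<noteq> 0" and k_pos: "0 < k" and z: "primitive_root_of_unity (2 * k) z"
begin

definition rep :: "(gen list \<Rightarrow> 'k) \<Rightarrow> (nat \<Rightarrow> nat) \<Rightarrow> nat set \<Rightarrow> nat set \<Rightarrow> 'k" where
  "rep f c T S = rep_entry q k (\<lambda>a. z ^ c a) f T S"

abbreviation "W \<equiv> weights (2 * k) n"
abbreviation "B \<equiv> Pow {1..n}"

lemma z_nonzero: "z \<noteq> 0"
proof -
  have "z ^ (2 * k) = 1" using z by (simp add: primitive_root_of_unity_def)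
  then show ?thesis using k_pos by (metis mult_pos_pos pos2 power_eq_0_iff zero_neq_one)
qed

lemma finite_indices: "finite W" "finite B"
  by (auto simp: weights_def intro: finite_PiE)

lemma finite_B_elem: "S \<in> B \<Longrightarrow> finite S"
  using finite_subset by blast

lemma rep_mult:
  "f \<in> FA n \<Longrightarrow> g \<in> FA n \<Longrightarrow> S \<in> B \<Longrightarrow> rep (fa_mult f g) c T S = (\<Sum>U\<in>B. rep f c T U * rep g c U S)"
  unfolding rep_def by (rule rep_entry_mult) auto

lemma rep_smul: "f \<in> FA n \<Longrightarrow> rep (fa_smul a f) c T S = a * rep f c T S"
  unfolding rep_def by (rule rep_entry_smul)

lemma rep_one: "rep fa_one c T S = (if T = S then 1 else 0)"
  using rep_entry_word[of q k "\<lambda>a. z ^ c a" "[]" T S] by (auto simp: rep_def word_entry_def)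

lemma rep_cl_ideal:
  assumes "x \<in> cl_ideal n k q" "S \<in> B"
  shows "rep x c T S = 0"
  using assms(1) assms(2)
proof (induction arbitrary: S T rule: cl_ideal.induct)
  case zero
  then show ?case using rep_entry_0[of q k] by (simp add: rep_def zero_fun_def)
next
  case (rel r a b)
  \<comment> \<open>Each \<open>z ^ c a\<close> is a \<open>2k\<close>-th root of unity, as the
    power relations demand.\<close>
  have zk: "(z ^ c a) ^ k * (z ^ c a) ^ k = 1" for a
  proof -
    have "(z ^ c a) ^ k * (z ^ c a) ^ k = z ^ (c a * k + c a * k)"
      by (simp only: power_mult power_add)
    also have "c a * k + c a * k = 2 * k * c a" by simp
    finally have "(z ^ c a) ^ k * (z ^ c a) ^ k = (z ^ (2 * k)) ^ c a" by (simp only: power_mult)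
    then show ?thesis using z by (simp add: primitive_root_of_unity_def)
  qed
  have r: "r \<in> FA n" using rel cl_rels_FA by blast
  have "rep r c U V = 0" if "V \<in> B" for U V
    unfolding rep_def using rel zk that by (intro rep_entry_cl_rels[OF q_nonzero _ k_pos]) auto
  then have "rep (fa_mult a r) c T U = 0" if "U \<in> B" for U T
    using rel r that by (simp add: rep_mult)
  then show ?case using rel r by (subst rep_mult) (auto intro!: fa_mult_FA sum.neutral)
next
  case (add x y)
  then show ?case
    by (simp add: rep_def fa_add_eq_plus rep_entry_add[OF cl_ideal_FA[OF add.hyps(1)] cl_ideal_FA[OF add.hyps(2)]])
qed

section \<open>Matrix units and surjectivity\<close>

definition is_unit :: "(gen list \<Rightarrow> 'k) \<Rightarrow> (nat \<Rightarrow> nat) \<Rightarrow> nat set \<Rightarrow> nat set \<Rightarrow> bool" where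
  "is_unit f c0 T0 S0 \<longleftrightarrow> f \<in> FA n \<and>
     (\<forall>c\<in>W. \<forall>T\<in>B. \<forall>S\<in>B. rep f c T S = (if c = c0 \<and> T = T0 \<and> S = S0 then 1 else 0))"

text \<open>Diagonal matrices in the image, viewed as functions on pairs (weight, subset), so that
  the matrix product becomes pointwise multiplication.\<close>

definition diagonals :: "((nat \<Rightarrow> nat) \<times> nat set \<Rightarrow> 'k) set" where
  "diagonals = {d. \<exists>f\<in>FA n. \<forall>c\<in>W. \<forall>T\<in>B. \<forall>S\<in>B. rep f c T S = (if T = S then d (c, S) else 0)}"

lemma diagonalsI:
  "f \<in> FA n \<Longrightarrow> (\<And>c T S. c \<in> W \<Longrightarrow> T \<in> B \<Longrightarrow> S \<in> B \<Longrightarrow> rep f c T S = (if T = S then d (c, S) else 0))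
    \<Longrightarrow> d \<in> diagonals"
  unfolding diagonals_def by blast

lemma diagonals_algebra:
  shows "(\<lambda>_. 1) \<in> diagonals"
    and "d \<in> diagonals \<Longrightarrow> e \<in> diagonals \<Longrightarrow> (\<lambda>x. d x + e x) \<in> diagonals"
    and "d \<in> diagonals \<Longrightarrow> (\<lambda>x. a * d x) \<in> diagonals"
    and "d \<in> diagonals \<Longrightarrow> e \<in> diagonals \<Longrightarrow> (\<lambda>x. d x * e x) \<in> diagonals"
proof -
  show "(\<lambda>_. 1) \<in> diagonals" by (rule diagonalsI[OF fa_one_FA]) (simp add: rep_one)
  assume "d \<in> diagonals"
  then obtain f where f: "f \<in> FA n"
    "\<And>c T S. c \<in> W \<Longrightarrow> T \<in> B \<Longrightarrow> S \<in> B \<Longrightarrow> rep f c T S = (if T = S then d (c, S) else 0)"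
    unfolding diagonals_def by blast
  show "(\<lambda>x. a * d x) \<in> diagonals"
    by (rule diagonalsI[of "fa_smul a f"])
      (use f in \<open>auto simp: rep_smul fa.subspace_scale[OF subspace_FA]\<close>)
  assume "e \<in> diagonals"
  then obtain g where g: "g \<in> FA n"
    "\<And>c T S. c \<in> W \<Longrightarrow> T \<in> B \<Longrightarrow> S \<in> B \<Longrightarrow> rep g c T S = (if T = S then e (c, S) else 0)"
    unfolding diagonals_def by blast
  show "(\<lambda>x. d x + e x) \<in> diagonals"
    by (rule diagonalsI[of "f + g"])
      (use f g in \<open>auto simp: rep_def rep_entry_add[of f n] fa.subspace_add[OF subspace_FA]\<close>)
  show "(\<lambda>x. d x * e x) \<in> diagonals"
  proof (rule diagonalsI[OF fa_mult_FA[OF f(1) g(1)]])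
    fix c T S assume c: "c \<in> W" and T: "T \<in> B" and S: "S \<in> B"
    have "rep (fa_mult f g) c T S = (\<Sum>U\<in>B. rep f c T U * rep g c U S)"
      by (rule rep_mult[OF f(1) g(1) S])
    also have "\<dots> = (\<Sum>U\<in>B. if U = S then rep f c T S * e (c, S) else 0)"
      by (rule sum.cong) (use c T S g(2) in auto)
    also have "\<dots> = rep f c T S * e (c, S)"
      using S finite_indices(2) by (simp add: sum.delta)
    finally show "rep (fa_mult f g) c T S = (if T = S then d (c, S) * e (c, S) else 0)"
      using f(2)[OF c T S] by simp
  qed
qed

text \<open>The alternative in the last assumption covers vanishing coefficients, where
  \<open>word_move\<close> has no meaning: \<open>[Psi a, PsiS a]\<close> would remove
  \<open>a\<close> from a set containing it.\<close>

lemma word_diagonal: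
  assumes "set w \<subseteq> gens n" "\<And>c S. c \<in> W \<Longrightarrow> S \<in> B \<Longrightarrow> word_coef q k (\<lambda>a. z ^ c a) w S = d (c, S)"
    "\<And>S. S \<in> B \<Longrightarrow> word_move w S = S \<or> (\<forall>c. d (c, S) = 0)"
  shows "d \<in> diagonals"
proof (rule diagonalsI[OF fa_word_FA[OF assms(1)]])
  fix c T S assume "c \<in> W" "T \<in> B" "S \<in> B"
  then show "rep (fa_word w) c T S = (if T = S then d (c, S) else 0)"
    using assms(2)[of c S] assms(3)[of S] by (auto simp: rep_def rep_entry_word word_entry_def)
qed

text \<open>Different subsets are told apart by \<open>Psi a\<close> after \<open>PsiS a\<close>,
  which vanishes exactly where \<open>a\<close> is present. For equal subsets the power of
  \<open>q\<close> in \<open>Om a\<close> is common, and distinct exponents below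
  \<open>2 * k\<close> give distinct powers of \<open>z\<close>.\<close>

lemma diagonals_separate:
  assumes "x \<in> W \<times> B" "y \<in> W \<times> B" "x \<noteq> y"
  shows "\<exists>d\<in>diagonals. d x \<noteq> d y"
proof -
  obtain c S c' S' where xy: "x = (c, S)" "y = (c', S')" by fastforce
  show ?thesis
  proof (cases "S = S'")
    case False
    then obtain a where a: "a \<in> S \<longleftrightarrow> a \<notin> S'" by blast
    then have an: "a \<in> {1..n}" using assms xy by auto
    let ?d = "\<lambda>(c, S). if a \<in> S then 0 else (z ^ c a) ^ k"
    have "?d \<in> diagonals"
    proof (rule word_diagonal[of "[Psi a, PsiS a]"])
      show "word_coef q k (\<lambda>a. z ^ c a) [Psi a, PsiS a] S = ?d (c, S)" if "S \<in> B" for c S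
        using finite_B_elem[OF that] by (simp add: jw_sign_insert)
    qed (use an in \<open>auto simp: gens_def\<close>)
    moreover have "?d x \<noteq> ?d y" using a z_nonzero xy by auto
    ultimately show ?thesis by blast
  next
    case True
    then have "c \<noteq> c'" using assms xy by auto
    then obtain a where a: "a \<in> {1..n}" "c a \<noteq> c' a"
      using assms xy unfolding weights_def by (metis PiE_ext SigmaD1)
    let ?d = "\<lambda>(c, S). z ^ c a * (if a \<in> S then inverse q else 1)"
    have "?d \<in> diagonals"
      by (rule word_diagonal[of "[Om a]"]) (use a in \<open>auto simp: gens_def\<close>)
    moreover have "z ^ c a \<noteq> z ^ c' a"
      using primitive_root_powers_inj[OF z] k_pos a assms xy
      by (auto simp: weights_def PiE_iff inj_on_def)
    then have "?d x \<noteq> ?d y" using True xy q_nonzero by auto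
    ultimately show ?thesis by blast
  qed
qed

lemma diagonal_unit:
  assumes "c0 \<in> W" "S0 \<in> B"
  shows "\<exists>f. is_unit f c0 S0 S0"
proof -
  have "\<exists>d\<in>diagonals. d (c0, S0) = 1 \<and> (\<forall>y\<in>W \<times> B - {(c0, S0)}. d y = 0)"
  proof (rule separating_subalgebra_indicator)
    show "\<exists>d\<in>diagonals. d (c0, S0) \<noteq> d y" if "y \<in> W \<times> B - {(c0, S0)}" for y
      by (rule diagonals_separate) (use assms that in auto)
    show "finite (W \<times> B - {(c0, S0)})" using finite_indices by blast
  qed (fact diagonals_algebra)+
  then obtain d where d: "d \<in> diagonals" "d (c0, S0) = 1" "\<And>y. y \<in> W \<times> B - {(c0, S0)} \<Longrightarrow> d y = 0"
    by blast
  obtain f where f: "f \<in> FA n"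
    "\<And>c T S. c \<in> W \<Longrightarrow> T \<in> B \<Longrightarrow> S \<in> B \<Longrightarrow> rep f c T S = (if T = S then d (c, S) else 0)"
    using d(1) unfolding diagonals_def by blast
  have "rep f c T S = (if c = c0 \<and> T = S0 \<and> S = S0 then 1 else 0)" if "c \<in> W" "T \<in> B" "S \<in> B" for c T S
    using f(2)[OF that] d(2) d(3)[of "(c, S)"] that by auto
  then have "is_unit f c0 S0 S0" using f(1) by (simp add: is_unit_def)
  then show ?thesis by blast
qed

text \<open>Left multiplication by a generator moves the row of a matrix unit and scales it by a
  nonzero coefficient; the other components stay zero.\<close>

lemma move_unit:
  assumes f: "is_unit f c0 T0 S0" and g: "g \<in> gens n" and T0: "T0 \<in> B"
    and nz: "gen_coef q k (\<lambda>a. z ^ c0 a) g T0 \<noteq> 0"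
  shows "\<exists>f. is_unit f c0 (gen_move g T0) S0"
proof -
  let ?\<kappa> = "gen_coef q k (\<lambda>a. z ^ c0 a) g T0"
  define h where "h = fa_mult (fa_word [g]) f"
  have f': "f \<in> FA n" "\<And>c T S. c \<in> W \<Longrightarrow> T \<in> B \<Longrightarrow> S \<in> B \<Longrightarrow>
      rep f c T S = (if c = c0 \<and> T = T0 \<and> S = S0 then 1 else 0)"
    using f by (auto simp: is_unit_def)
  have g': "fa_word [g] \<in> FA n" using g by (intro fa_word_FA) simp
  have h: "h \<in> FA n" unfolding h_def by (rule fa_mult_FA[OF g' f'(1)])
  have "rep h c T S = (if c = c0 \<and> T = gen_move g T0 \<and> S = S0 then ?\<kappa> else 0)"
    if "c \<in> W" "T \<in> B" "S \<in> B" for c T S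
  proof -
    have "rep h c T S = (\<Sum>U\<in>B. rep (fa_word [g]) c T U * rep f c U S)"
      unfolding h_def by (rule rep_mult[OF g' f'(1) that(3)])
    also have "\<dots> = (\<Sum>U\<in>B. if U = T0 then if c = c0 \<and> S = S0 then rep (fa_word [g]) c T T0 else 0 else 0)"
      by (rule sum.cong) (use that f'(2) in auto)
    also have "\<dots> = (if c = c0 \<and> S = S0 then rep (fa_word [g]) c T T0 else 0)"
      using T0 finite_indices(2) by (simp add: sum.delta)
    finally show ?thesis by (auto simp: rep_def rep_entry_word[of _ _ _ "[g]", simplified] word_entry_def)
  qed
  then have "is_unit (fa_smul (inverse ?\<kappa>) h) c0 (gen_move g T0) S0"
    unfolding is_unit_def using nz h
    by (simp add: rep_smul fa.subspace_scale[OF subspace_FA])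
  then show ?thesis by blast
qed

lemma jw_sign_nonzero: "jw_sign a S \<noteq> (0 :: 'k)"
  by (simp add: jw_sign_def)

lemma lower_unit:
  assumes "finite T" "T \<in> B" "\<exists>f. is_unit f c0 T S0"
  shows "\<exists>f. is_unit f c0 {} S0"
  using assms
proof (induction T rule: finite_induct)
  case (insert a T)
  then obtain f where "is_unit f c0 (insert a T) S0" by blast
  then have "\<exists>f. is_unit f c0 (gen_move (Psi a) (insert a T)) S0"
    by (rule move_unit) (use insert.prems z_nonzero in \<open>auto simp: gens_def jw_sign_nonzero\<close>)
  then show ?case using insert by auto
qed

lemma raise_unit:
  assumes "finite T" "T \<in> B" "\<exists>f. is_unit f c0 {} S0"
  shows "\<exists>f. is_unit f c0 T S0"
  using assms
proof (induction T rule: finite_induct)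
  case (insert a T)
  then obtain f where "is_unit f c0 T S0" by auto
  then have "\<exists>f. is_unit f c0 (gen_move (PsiS a) T) S0"
    by (rule move_unit) (use insert in \<open>auto simp: gens_def jw_sign_nonzero\<close>)
  then show ?case by simp
qed

text \<open>Start from the diagonal unit at \<open>S0\<close>, lower its row to the empty set, then
  raise it to \<open>T0\<close>. The column stays \<open>S0\<close> throughout.\<close>

lemma unit_exists:
  assumes "c0 \<in> W" "T0 \<in> B" "S0 \<in> B"
  shows "\<exists>f. is_unit f c0 T0 S0"
proof -
  have "\<exists>f. is_unit f c0 {} S0"
    by (rule lower_unit[OF finite_B_elem[OF assms(3)] assms(3) diagonal_unit[OF assms(1,3)]])
  then show ?thesis by (rule raise_unit[OF finite_B_elem[OF assms(2)] assms(2)])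
qed

lemma rep_surjective:
  obtains f where "f \<in> FA n" "\<And>c T S. c \<in> W \<Longrightarrow> T \<in> B \<Longrightarrow> S \<in> B \<Longrightarrow> rep f c T S = X c T S"
proof -
  define E where "E c T S = (SOME f. is_unit f c T S)" for c T S
  have E: "is_unit (E c T S) c T S" if "c \<in> W" "T \<in> B" "S \<in> B" for c T S
    unfolding E_def using unit_exists[OF that] by (rule someI_ex)
  let ?J = "W \<times> B \<times> B"
  let ?F = "\<lambda>(c, T, S). fa_smul (X c T S) (E c T S)"
  have EF: "E c T S \<in> FA n" if "(c, T, S) \<in> ?J" for c T S using that E by (auto simp: is_unit_def)
  have F: "?F x \<in> FA n" if "x \<in> ?J" for x
    using that EF by (auto simp: fa.subspace_scale[OF subspace_FA])
  show ?thesis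
  proof (rule that[of "\<Sum>x\<in>?J. ?F x"])
    show "(\<Sum>x\<in>?J. ?F x) \<in> FA n" by (rule fa.subspace_sum[OF subspace_FA F])
    fix c T S assume cTS: "c \<in> W" "T \<in> B" "S \<in> B"
    have "rep (\<Sum>x\<in>?J. ?F x) c T S = (\<Sum>x\<in>?J. rep (?F x) c T S)"
      unfolding rep_def by (rule rep_entry_sum[OF F])
    also have "\<dots> = (\<Sum>x\<in>?J. if x = (c, T, S) then X c T S else 0)"
    proof (rule sum.cong)
      fix x assume x: "x \<in> ?J"
      obtain c' T' S' where x': "x = (c', T', S')" by (cases x)
      have "rep (?F x) c T S = X c' T' S' * rep (E c' T' S') c T S"
        using EF x x' by (simp add: rep_smul)
      then show "rep (?F x) c T S = (if x = (c, T, S) then X c T S else 0)"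
        using E[of c' T' S'] x x' cTS by (auto simp: is_unit_def)
    qed simp
    also have "\<dots> = X c T S" using cTS finite_indices by (simp add: sum.delta)
    finally show "rep (\<Sum>x\<in>?J. ?F x) c T S = X c T S" .
  qed
qed

end

text \<open>The isomorphism takes the form of a surjective unital homomorphism on the free algebra
  whose kernel is the ideal of relations. It remains to number weights and subsets by arbitrary
  bijections.\<close>

theorem theorem4p5:
  fixes q :: "'k::field" and n k :: nat
  assumes "(2::'k) \<noteq> 0" and "q \<noteq> 0" and "0 < n" and "0 < k"
    and "\<exists>z::'k. primitive_root_of_unity (2 * k) z"
  shows "\<exists>\<phi> :: (gen list \<Rightarrow> 'k) \<Rightarrow> (nat \<Rightarrow> nat \<Rightarrow> nat \<Rightarrow> 'k).
           \<phi> ` FA n = matsum ((2 * k) ^ n) (2 ^ n)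
         \<and> (\<forall>f\<in>FA n. \<forall>g\<in>FA n. \<phi> (fa_add f g) = ms_add (\<phi> f) (\<phi> g))
         \<and> (\<forall>c. \<forall>f\<in>FA n. \<phi> (fa_smul c f) = ms_smul c (\<phi> f))
         \<and> (\<forall>f\<in>FA n. \<forall>g\<in>FA n. \<phi> (fa_mult f g) = ms_mult (2 ^ n) (\<phi> f) (\<phi> g))
         \<and> \<phi> fa_one = ms_one ((2 * k) ^ n) (2 ^ n)
         \<and> {f \<in> FA n. \<phi> f = (\<lambda>_ _ _. 0)} = cl_ideal n k q"
proof -
  obtain z :: 'k where z: "primitive_root_of_unity (2 * k) z" using assms by blast
  interpret clifford_rep q z n k using assms z by unfold_locales
  let ?N = "(2 * k) ^ n" and ?d = "2 ^ n :: nat"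
  have "card W = ?N" by (simp add: weights_def card_PiE)
  then obtain \<gamma> where \<gamma>: "bij_betw \<gamma> {..<?N} W"
    using ex_bij_betw_nat_finite[OF finite_indices(1)] by (auto simp: atLeast0LessThan)
  have "card B = ?d" by (simp add: card_Pow)
  then obtain \<beta> where \<beta>: "bij_betw \<beta> {..<?d} B"
    using ex_bij_betw_nat_finite[OF finite_indices(2)] by (auto simp: atLeast0LessThan)
  have \<gamma>W: "\<gamma> c \<in> W" if "c < ?N" for c using \<gamma> that by (auto simp: bij_betw_def)
  have \<beta>B: "\<beta> i \<in> B" if "i < ?d" for i using \<beta> that by (auto simp: bij_betw_def)
  have \<beta>_inj: "\<beta> i = \<beta> j \<longleftrightarrow> i = j" if "i < ?d" "j < ?d" for i j
    using \<beta> that by (auto simp: bij_betw_def inj_on_def)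
  \<comment> \<open>Zero outside the index range, as membership in \<open>matsum\<close>
    requires.\<close>
  define \<phi> where "\<phi> f c i j = (if c < ?N \<and> i < ?d \<and> j < ?d then rep f (\<gamma> c) (\<beta> i) (\<beta> j) else 0)" for f c i j
  have surj: "matsum ?N ?d \<subseteq> \<phi> ` FA n"
  proof
    fix X :: "nat \<Rightarrow> nat \<Rightarrow> nat \<Rightarrow> 'k" assume X: "X \<in> matsum ?N ?d"
    define \<gamma>' \<beta>' where "\<gamma>' = inv_into {..<?N} \<gamma>" and "\<beta>' = inv_into {..<?d} \<beta>"
    obtain f where f: "f \<in> FA n"
      "\<And>c T S. c \<in> W \<Longrightarrow> T \<in> B \<Longrightarrow> S \<in> B \<Longrightarrow> rep f c T S = X (\<gamma>' c) (\<beta>' T) (\<beta>' S)"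
      using rep_surjective[of "\<lambda>c T S. X (\<gamma>' c) (\<beta>' T) (\<beta>' S)"] by blast
    have "\<phi> f c i j = X c i j" for c i j
    proof (cases "c < ?N \<and> i < ?d \<and> j < ?d")
      case True
      then have "\<gamma>' (\<gamma> c) = c" "\<beta>' (\<beta> i) = i" "\<beta>' (\<beta> j) = j"
        using bij_betw_inv_into_left[OF \<gamma>] bij_betw_inv_into_left[OF \<beta>] by (auto simp: \<gamma>'_def \<beta>'_def)
      then show ?thesis using True f(2) \<gamma>W \<beta>B by (simp add: \<phi>_def)
    next
      case False
      then show ?thesis using X by (auto simp: \<phi>_def matsum_def)
    qed
    then have "X = \<phi> f" by (simp add: fun_eq_iff)
    then show "X \<in> \<phi> ` FA n" using f(1) by blast
  qed
  have mult: "\<phi> (fa_mult f g) = ms_mult ?d (\<phi> f) (\<phi> g)" if f: "f \<in> FA n" and g: "g \<in> FA n" for f g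
  proof (intro ext)
    fix c i j
    show "\<phi> (fa_mult f g) c i j = ms_mult ?d (\<phi> f) (\<phi> g) c i j"
    proof (cases "c < ?N \<and> i < ?d \<and> j < ?d")
      case True
      then have "\<phi> (fa_mult f g) c i j = (\<Sum>U\<in>B. rep f (\<gamma> c) (\<beta> i) U * rep g (\<gamma> c) U (\<beta> j))"
        using rep_mult[OF f g \<beta>B] by (simp add: \<phi>_def)
      also have "\<dots> = (\<Sum>l<?d. rep f (\<gamma> c) (\<beta> i) (\<beta> l) * rep g (\<gamma> c) (\<beta> l) (\<beta> j))"
        by (rule sum.reindex_bij_betw[OF \<beta>, symmetric])
      finally show ?thesis using True by (simp add: \<phi>_def ms_mult_def)
    qed (auto simp: \<phi>_def ms_mult_def)
  qed
  \<comment> \<open>The numberings are onto, so a vanishing \<open>\<phi> f\<close> makes the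
    matrices of \<open>f\<close> vanish at all weights.\<close>
  have zero: "rep f c T S = 0" if f: "\<phi> f = (\<lambda>_ _ _. 0)" and "c \<in> W" "T \<in> B" "S \<in> B" for f c T S
  proof -
    have "c \<in> \<gamma> ` {..<?N}" "T \<in> \<beta> ` {..<?d}" "S \<in> \<beta> ` {..<?d}"
      using that \<gamma> \<beta> by (simp_all add: bij_betw_def)
    then obtain c' i j where "c = \<gamma> c'" "c' < ?N" "T = \<beta> i" "i < ?d" "S = \<beta> j" "j < ?d"
      by blast
    then show ?thesis using fun_cong[OF fun_cong[OF fun_cong[OF f]], of c' i j] by (simp add: \<phi>_def)
  qed
  show ?thesis
  proof (intro exI[of _ \<phi>] conjI ballI allI)
    show "\<phi> ` FA n = matsum ?N ?d"
    proof (rule antisym[OF _ surj])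
      have "\<phi> f \<in> matsum ?N ?d" for f by (simp add: \<phi>_def matsum_def)
      then show "\<phi> ` FA n \<subseteq> matsum ?N ?d" by blast
    qed
    show "\<phi> (fa_add f g) = ms_add (\<phi> f) (\<phi> g)" if "f \<in> FA n" "g \<in> FA n" for f g
      using rep_entry_add[OF that] by (auto simp: fun_eq_iff \<phi>_def ms_add_def fa_add_eq_plus rep_def)
    show "\<phi> (fa_smul c f) = ms_smul c (\<phi> f)" if "f \<in> FA n" for c f
      using rep_smul[OF that] by (auto simp: fun_eq_iff \<phi>_def ms_smul_def)
    show "\<phi> fa_one = ms_one ?N ?d"
      using \<beta>_inj by (auto simp: fun_eq_iff \<phi>_def ms_one_def rep_one)
    show "{f \<in> FA n. \<phi> f = (\<lambda>_ _ _. 0)} = cl_ideal n k q"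
    proof (intro set_eqI iffI)
      fix f assume "f \<in> {f \<in> FA n. \<phi> f = (\<lambda>_ _ _. 0)}"
      then show "f \<in> cl_ideal n k q"
        using kernel_subset_cl_ideal[OF assms(1,2,4) z, of f n] zero[of f] by (auto simp: rep_def)
    next
      fix f assume "f \<in> cl_ideal n k q"
      then show "f \<in> {f \<in> FA n. \<phi> f = (\<lambda>_ _ _. 0)}"
        using rep_cl_ideal \<beta>B by (auto simp: fun_eq_iff \<phi>_def cl_ideal_FA)
    qed
  qed (use mult in auto)
qed

end
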